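(* Let $k\geq 2$ and $n$ be integers with $n\geq (2k)^{8k^2}$. Then $$\operatorname{ex}(n,C_{2k})\leq 80\sqrt{k}\,\log k\cdot n^{1+1/k}+10k^2 n .$$ Equivalently, every $n$-vertex graph $G$ that contains no cycle of length $2k$ has at most $80\sqrt{k}\,\log k\cdot n^{1+1/k}+10k^2n$ edges.
   Context: Graphs are finite and simple. $C_{2k}$ is the cycle of length $2k$. $\operatorname{ex}(n,F)$ is the largest number of edges in an $n$-vertex graph that contains no copy of $F$ as a (not necessarily induced) subgraph. $\log$ is the natural logarithm. *)

theory Defs
  imports Complex_Main
begin

record 'a ugraph =
  verts :: "'a set"
  edges :: "'a set set"

definition simple_graph :: "'a ugraph \<Rightarrow> bool" where
  "simple_graph G \<longleftrightarrow> finite (verts G) \<and> (\<forall>e\<in>edges G. e \<subseteq> verts G \<and> card e = 2)"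

text \<open>Copies are not necessarily induced: only edges of \<open>F\<close> have to be preserved.\<close>

definition contains_copy :: "'a ugraph \<Rightarrow> 'b ugraph \<Rightarrow> bool" where
  "contains_copy G F \<longleftrightarrow>
     (\<exists>f. inj_on f (verts F) \<and> f ` verts F \<subseteq> verts G \<and> (\<forall>e\<in>edges F. f ` e \<in> edges G))"

text \<open>This is the usual cycle only for \<open>m \<ge> 3\<close>.\<close>

definition cycle_graph :: "nat \<Rightarrow> nat ugraph" where
  "cycle_graph m = \<lparr>verts = {..<m}, edges = {{i, (i + 1) mod m} | i. i < m}\<rparr>"

text \<open>Up to isomorphism every finite graph has its vertices in \<open>nat\<close>. The set below is finite;
  it is nonempty if \<open>F\<close> has an edge, and only then is the maximum guaranteed to be meaningful.\<close>

definition ex_num :: "nat \<Rightarrow> 'b ugraph \<Rightarrow> nat" where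
  "ex_num n F = Max {card (edges G) | G :: nat ugraph.
     simple_graph G \<and> card (verts G) = n \<and> \<not> contains_copy G F}"

lemma finite_edge_counts:
  "finite {card (edges G) | G :: nat ugraph.
     simple_graph G \<and> card (verts G) = n \<and> \<not> contains_copy G F}"
proof (rule finite_subset[of _ "{..2 ^ n}"])
  have "card (edges G) \<le> 2 ^ card (verts G)" if "simple_graph G" for G :: "nat ugraph"
    using that card_mono[of "Pow (verts G)" "edges G"]
    by (auto simp: simple_graph_def card_Pow)
  then show "{card (edges G) | G :: nat ugraph.
     simple_graph G \<and> card (verts G) = n \<and> \<not> contains_copy G F} \<subseteq> {..2 ^ n}"
    by auto
qed simp

lemma edge_counts_nonempty:
  assumes "edges F \<noteq> {}"
  shows "{card (edges G) | G :: nat ugraph.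
     simple_graph G \<and> card (verts G) = n \<and> \<not> contains_copy G F} \<noteq> {}"
proof -
  let ?G = "\<lparr>verts = {..<n}, edges = {}\<rparr> :: nat ugraph"
  have "simple_graph ?G \<and> card (verts ?G) = n \<and> \<not> contains_copy ?G F"
    using assms by (auto simp: simple_graph_def contains_copy_def)
  then show ?thesis by blast
qed

end

theory Submission
  imports Defs
begin

text \<open>Following Bondy--Simonovits and Pikhurko, explore a dense bipartite graph H without 2k-cycles by the
  distance levels from a vertex x. A theta graph (a cycle of length at least 2k with a chord) whose
  vertices on level i have neighbours on level i - 1 outside of it can be closed up, through the
  breadth first tree, to a 2k-cycle. As theta graphs between two consecutive levels are of this kind, at
  most about 2k|X \<union> Y| edges run between subsets X and Y of consecutive levels, so every level is larger
  than the previous one by a factor of about d/k. This suffices for k < 1024.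

  The factor \<open>\<surd>k log k\<close> for large k comes from two steps at once, an idea of Bukh and Jiang. If level
  i + 1 is too small compared to level i - 1, a dyadic pigeonhole and a pruning of the three levels leave
  layers X1, X2, X3 with minimum degrees A, C (huge) downwards and B, D with BD about k log k
  upwards. A path is grown greedily through these layers, returning to X1 only once for every D vertices in
  X2; it gets stuck only when a vertex of X2 has many neighbours of X1 on the path, and these, being
  far apart, give a theta graph. A shortest such theta graph uses few neighbours in X1 of each
  of its vertices in X2, so it closes up to a 2k-cycle. The maximum degree is under control because x
  has maximum degree, so that a larger one would already be impossible by the weaker growth.\<close>

section \<open>Paths in cycles with a chord\<close>

text \<open>A single step away from the root loses a factor of order k, since
  \<open>ec_level_pair\<close> tolerates about 2k edges per vertex. With three layers a
  contradiction arises as soon as the product of the degrees \<open>B\<close> and \<open>D\<close>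
  towards the root is of order k, so two steps together lose only k times the number of dyadic
  classes of degrees below 4k, which is of order log k. The obstacle is that a theta graph meeting
  level i - 1 may contain all neighbours there of one of its own vertices on level i, and then no
  tree path can leave it. Keeping the X1 vertices 2D positions apart ties the number of such
  neighbours to length: about k/D of them already span 2k positions, while \<open>B\<close> exceeds
  twice that number. The size of n pays for the greedy growth. The sets to be avoided grow by a
  factor 1 + 128k in each of fewer than k steps, and the maximum degree may exceed d by a factor
  (2k)^(k-1). Since n is at least (2k)^(8k^2), d is at least (2k)^(8k), which dominates the product
  of both effects.\<close>

lemma int_periodic_multiple:
  fixes f :: "int \<Rightarrow> 'b"
  assumes "\<And>j. f (j + p) = f j"
  shows "f (j + t * p) = f j"
proof -
  have nat_case: "f (j + int n * p) = f j" for n j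
  proof (induction n)
    case (Suc n)
    have "f (j + int (Suc n) * p) = f ((j + int n * p) + p)"
      by (simp add: algebra_simps)
    then show ?case using assms Suc by simp
  qed simp
  show ?thesis
  proof (cases "t \<ge> 0")
    case True
    then show ?thesis using nat_case[of j "nat t"] by simp
  next
    case False
    then show ?thesis using nat_case[of "j + t * p" "nat (- t)"] by simp
  qed
qed

lemma int_periodic_agree:
  fixes f g :: "int \<Rightarrow> 'b"
  assumes "p > 0" "\<And>j. f (j + p) = f j" "\<And>j. g (j + p) = g j"
    and "\<And>j. l \<le> j \<Longrightarrow> j < l + p \<Longrightarrow> f j = g j"
  shows "f j = g j"
proof -
  define i where "i = l + (j - l) mod p"
  have i: "l \<le> i" "i < l + p"
    using assms(1) by (auto simp: i_def)
  have "i + ((j - l) div p) * p = j"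
    unfolding i_def using div_mult_mod_eq[of "j - l" p] by linarith
  then show ?thesis
    using int_periodic_multiple[of f p i, OF assms(2)] int_periodic_multiple[of g p i, OF assms(3)]
      assms(4)[OF i] by metis
qed

text \<open>Here the value of the colouring at i is the colour of vertex 2i of a cycle of length 2M, which has a
  chord from vertex 0 to vertex 2r + 1. The assumptions say that the end points of a path of length 2s have
  the same colour: the path runs along the cycle, or it uses the chord in one of four ways (t1 to t4),
  with 2a edges before and 2b + 1 edges after the chord.\<close>

lemma chord_colouring_constant:
  fixes \<chi> :: "int \<Rightarrow> bool" and M r s :: int
  assumes r: "1 \<le> r" "r \<le> M - 2" and s: "1 \<le> s" "s \<le> M - 1"
    and perM: "\<And>j. \<chi> (j + M) = \<chi> j" and perS: "\<And>j. \<chi> (j + s) = \<chi> j"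
    and t1: "\<And>a b. \<lbrakk>0 \<le> a; 0 \<le> b; a + b = s - 1; s \<le> M - r - 1\<rbrakk> \<Longrightarrow> \<chi> (- a) = \<chi> (r + 1 + b)"
    and t2: "\<And>a b. \<lbrakk>0 \<le> a; 0 \<le> b; a + b = s - 1; s \<le> r\<rbrakk> \<Longrightarrow> \<chi> a = \<chi> (r - b)"
    and t3: "\<And>a b. \<lbrakk>0 \<le> a; 0 \<le> b; a + b = s - 1; a \<le> M - r - 1; b \<le> r - 1\<rbrakk> \<Longrightarrow> \<chi> (- a) = \<chi> (r - b)"
    and t4: "\<And>a b. \<lbrakk>0 \<le> a; 0 \<le> b; a + b = s - 1; a \<le> r; b \<le> M - r - 2\<rbrakk> \<Longrightarrow> \<chi> a = \<chi> (r + 1 + b)"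
  shows "\<chi> i = \<chi> j"
proof -
  \<comment> \<open>\<open>t3\<close> and \<open>t4\<close> hold only for restricted
    \<open>a\<close>; a period \<open>p\<close> at most as long as both ranges makes them valid for
    all integers. They then say that the colouring is invariant under the reflections sending y to
    \<open>r + 1 - y\<close> and to \<open>r - y\<close>, whose composition is the translation by 1.
    Where \<open>s\<close> is too long, \<open>t2\<close> or \<open>t1\<close> supplies the period
    \<open>M - r - 1\<close> or \<open>r\<close>; if neither applies, \<open>M - s\<close> fits both
    ranges exactly.\<close>
  have "\<exists>p l l'. p > 0 \<and> (\<forall>j. \<chi> (j + p) = \<chi> j)
      \<and> (\<forall>a. l \<le> a \<and> a < l + p \<longrightarrow> 0 \<le> a \<and> a \<le> s - 1 \<and> a \<le> M - r - 1 \<and> s - 1 - a \<le> r - 1)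
      \<and> (\<forall>a. l' \<le> a \<and> a < l' + p \<longrightarrow> 0 \<le> a \<and> a \<le> s - 1 \<and> a \<le> r \<and> s - 1 - a \<le> M - r - 2)"
  proof (cases "s \<le> r"; cases "s \<le> M - r - 1")
    assume "s \<le> r" "s \<le> M - r - 1"
    then show ?thesis using s r perS by (intro exI[of _ s] exI[of _ 0]) auto
  next
    assume c: "s \<le> r" "\<not> s \<le> M - r - 1"
    have "\<chi> a = \<chi> (r + 1 + a)" for a
    proof (rule int_periodic_agree[of s \<chi> "\<lambda>a. \<chi> (r + 1 + a)" 0])
      fix j assume j: "0 \<le> j" "j < 0 + s"
      have "\<chi> j = \<chi> (r - (s - 1 - j))" using t2[of j "s - 1 - j"] j c by auto
      also have "\<dots> = \<chi> (r - (s - 1 - j) + s)" by (rule perS[symmetric])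
      also have "r - (s - 1 - j) + s = r + 1 + j" by simp
      finally show "\<chi> j = \<chi> (r + 1 + j)" .
    next
      fix j show "\<chi> (r + 1 + (j + s)) = \<chi> (r + 1 + j)" using perS[of "r + 1 + j"] by (simp add: add.assoc)
    qed (use s in simp, rule perS)
    then have "\<chi> (j + (M - r - 1)) = \<chi> (r + 1 + (j + (M - r - 1)))" for j .
    moreover have "r + 1 + (j + (M - r - 1)) = j + M" for j by simp
    ultimately have "\<chi> (j + (M - r - 1)) = \<chi> j" for j
      using perM by metis
    then show ?thesis using s r c
      by (intro exI[of _ "M - r - 1"] exI[of _ 0] exI[of _ "s - (M - r - 1)"]) auto
  next
    assume c: "\<not> s \<le> r" "s \<le> M - r - 1"
    have "\<chi> (- a) = \<chi> (r - a)" for a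
    proof (rule int_periodic_agree[of s "\<lambda>a. \<chi> (- a)" "\<lambda>a. \<chi> (r - a)" 0])
      fix j assume j: "0 \<le> j" "j < 0 + s"
      have "\<chi> (- j) = \<chi> (r + 1 + (s - 1 - j))" using t1[of j "s - 1 - j"] j c by auto
      also have "r + 1 + (s - 1 - j) = (r - j) + s" by simp
      finally show "\<chi> (- j) = \<chi> (r - j)" using perS by simp
    next
      fix j show "\<chi> (- (j + s)) = \<chi> (- j)" using perS[of "- j - s"] by simp
      show "\<chi> (r - (j + s)) = \<chi> (r - j)" using perS[of "r - j - s"] by (simp add: diff_diff_eq)
    qed (use s in simp)
    from this[of "- j" for j] have "\<chi> (j + r) = \<chi> j" for j
      by (simp add: add.commute)
    then show ?thesis using s r c
      by (intro exI[of _ r] exI[of _ "s - r"] exI[of _ 0]) auto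
  next
    assume c: "\<not> s \<le> r" "\<not> s \<le> M - r - 1"
    have "\<chi> (j + (M - s)) = \<chi> j" for j
      using perM[of "j"] perS[of "j + (M - s)"] by simp
    then show ?thesis using s r c
      by (intro exI[of _ "M - s"] exI[of _ "s - r"] exI[of _ "s - M + r + 1"]) auto
  qed
  then obtain p l l' where p: "p > 0" "\<And>j. \<chi> (j + p) = \<chi> j"
    and l: "\<And>a. l \<le> a \<Longrightarrow> a < l + p \<Longrightarrow> 0 \<le> a \<and> a \<le> s - 1 \<and> a \<le> M - r - 1 \<and> s - 1 - a \<le> r - 1"
    and l': "\<And>a. l' \<le> a \<Longrightarrow> a < l' + p \<Longrightarrow> 0 \<le> a \<and> a \<le> s - 1 \<and> a \<le> r \<and> s - 1 - a \<le> M - r - 2"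
    by blast
  have neg: "\<chi> (c - (j + p)) = \<chi> (c - j)" for c j
    using p(2)[of "c - (j + p)"] by (simp add: algebra_simps)
  have pos: "\<chi> (c + (j + p)) = \<chi> (c + j)" for c j
    using p(2)[of "c + j"] by (simp add: algebra_simps)
  have refl1: "\<chi> (0 - a) = \<chi> (r + 1 + a)" for a
  proof (rule int_periodic_agree[of p "\<lambda>a. \<chi> (0 - a)" "\<lambda>a. \<chi> (r + 1 + a)" l])
    fix j assume j: "l \<le> j" "j < l + p"
    have "\<chi> (- j) = \<chi> (r - (s - 1 - j))" using t3[of j "s - 1 - j"] l[OF j] by auto
    also have "\<dots> = \<chi> (r - (s - 1 - j) + s)" by (rule perS[symmetric])
    also have "r - (s - 1 - j) + s = r + 1 + j" by simp
    finally show "\<chi> (0 - j) = \<chi> (r + 1 + j)" by simp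
  qed (rule p(1) neg pos)+
  have refl2: "\<chi> (0 + a) = \<chi> (r - a)" for a
  proof (rule int_periodic_agree[of p "\<lambda>a. \<chi> (0 + a)" "\<lambda>a. \<chi> (r - a)" l'])
    fix j assume j: "l' \<le> j" "j < l' + p"
    have "\<chi> j = \<chi> (r + 1 + (s - 1 - j))" using t4[of j "s - 1 - j"] l'[OF j] by auto
    also have "r + 1 + (s - 1 - j) = (r - j) + s" by simp
    finally show "\<chi> (0 + j) = \<chi> (r - j)" using perS by simp
  qed (rule p(1) neg pos)+
  have step: "\<chi> (x + 1) = \<chi> x" for x
    using refl1[of "x - r"] refl2[of "r - x"] by (simp add: algebra_simps)
  show ?thesis
    using int_periodic_multiple[of \<chi> 1 0 i, OF step] int_periodic_multiple[of \<chi> 1 0 j, OF step]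
    by simp
qed

section \<open>Paths along a cycle and across its chord\<close>

definition gpath :: "('a \<Rightarrow> 'a \<Rightarrow> bool) \<Rightarrow> 'a list \<Rightarrow> bool" where
  "gpath E ps \<longleftrightarrow> ps \<noteq> [] \<and> distinct ps \<and> successively E ps"

lemma gpath_rev:
  assumes "\<And>u v. E u v \<Longrightarrow> E v u" "gpath E ps"
  shows "gpath E (rev ps)"
  using assms unfolding gpath_def by (auto elim!: successively_mono)

text \<open>Indexing the cycle by all integers modulo \<open>2 * M\<close> turns an arc through the
  starting point into an ordinary interval and a change of starting point into a shift. The bounds
  on \<open>r\<close> say that the chord is not an edge of the cycle.\<close>

locale chorded_cycle =
  fixes E :: "'a \<Rightarrow> 'a \<Rightarrow> bool" and c :: "int \<Rightarrow> 'a" and M r :: int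
  assumes sym: "E u v \<Longrightarrow> E v u"
    and c_eq_iff: "c i = c j \<longleftrightarrow> i mod (2 * M) = j mod (2 * M)"
    and cycle_edge: "E (c j) (c (j + 1))"
    and chord: "E (c 0) (c (2 * r + 1))"
    and r: "1 \<le> r" "r \<le> M - 2"
begin

lemma inj_on_window:
  assumes "u < l + 2 * M"
  shows "inj_on c {l..u}"
proof
  fix x y assume xy: "x \<in> {l..u}" "y \<in> {l..u}" "c x = c y"
  then have "2 * M dvd x - y" by (simp add: c_eq_iff mod_eq_dvd_iff)
  moreover have "\<bar>x - y\<bar> < 2 * M" using xy assms by auto
  ultimately show "x = y" using zdvd_imp_le[of "2 * M" "\<bar>x - y\<bar>"] by (cases "x = y") auto
qed

lemma successively_arc: "successively E (map c [a..b])"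
  unfolding successively_conv_nth
proof (intro allI impI)
  fix i assume "Suc i < length (map c [a..b])"
  then show "E (map c [a..b] ! i) (map c [a..b] ! Suc i)"
    using cycle_edge[of "a + int i"] by (simp add: add.assoc add.commute[of 1])
qed

lemma successively_rev_arc: "successively E (rev (map c [a..b]))"
  unfolding successively_rev by (rule successively_mono[OF successively_arc]) (rule sym)

lemma gpath_arc:
  assumes "a \<le> b" "b < a + 2 * M"
  shows "gpath E (map c [a..b])"
  using assms inj_on_window[of b a] successively_arc
  by (auto simp: gpath_def distinct_map)

text \<open>Both arcs lie in one window of \<open>2 * M\<close> consecutive indices, on which
  \<open>c\<close> is injective, so disjoint intervals of indices give disjoint sets of
  vertices.\<close>

lemma gpath_chord:
  assumes "xs = map c [a1..b1] \<or> xs = rev (map c [a1..b1])"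
    and "ys = map c [a2..b2] \<or> ys = rev (map c [a2..b2])"
    and "a1 \<le> b1" "b1 < a2" "a2 \<le> b2" "b2 < a1 + 2 * M"
    and "last xs = c 0" "hd ys = c (2 * r + 1)"
  shows "gpath E (xs @ ys)"
proof -
  have inj: "inj_on c {a1..b2}" using inj_on_window assms(6) .
  have sub: "{a1..b1} \<subseteq> {a1..b2}" "{a2..b2} \<subseteq> {a1..b2}" using assms by auto
  have sets: "set xs = c ` {a1..b1}" "set ys = c ` {a2..b2}" using assms(1,2) by auto
  have "set xs \<inter> set ys = c ` ({a1..b1} \<inter> {a2..b2})"
    unfolding sets by (rule inj_on_image_Int[OF inj sub, symmetric])
  also have "\<dots> = {}" using assms by auto
  finally have "set xs \<inter> set ys = {}" .
  moreover have "distinct xs" "distinct ys"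
    using assms(1,2) inj_on_subset[OF inj sub(1)] inj_on_subset[OF inj sub(2)]
    by (auto simp: distinct_map)
  moreover have "successively E xs" "successively E ys"
    using assms(1,2) successively_arc successively_rev_arc by metis+
  ultimately show ?thesis using assms chord by (auto simp: gpath_def successively_append_iff)
qed

text \<open>This is \<open>chord_colouring_constant\<close> for the colours of the even vertices. An
  arc of \<open>2 * s\<close> edges yields the period \<open>s\<close>; a path with
  \<open>2 * a\<close> edges before the chord and \<open>2 * b + 1\<close> after it has
  \<open>2 * (a + b + 1) = 2 * s\<close> edges, and the two directions of each arc give the four
  cases.\<close>

lemma even_path_colour_constant:
  fixes P :: "'a \<Rightarrow> bool"
  assumes s: "1 \<le> s" "s \<le> M - 1"
    and P: "\<And>ps. \<lbrakk>gpath E ps; length ps = nat (2 * s + 1); set ps \<subseteq> range c;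
        hd ps \<in> range (\<lambda>i. c (2 * i)); last ps \<in> range (\<lambda>i. c (2 * i))\<rbrakk> \<Longrightarrow> P (hd ps) = P (last ps)"
  shows "P (c (2 * i)) = P (c (2 * j))"
proof -
  have ends: "P (c (2 * x)) = P (c (2 * y))"
    if "gpath E ps" "length ps = nat (2 * s + 1)" "set ps \<subseteq> range c"
      "hd ps = c (2 * x)" "last ps = c (2 * y)" for ps x y
    using P[of ps] that by auto
  note defs = hd_map last_map hd_rev last_rev hd_append last_append
  have hdu: "hd [x..y] = x" "last [x..y] = y" if "x \<le> y" for x y :: int
    using that by (simp add: upto_rec1, simp add: upto_rec2)
  show ?thesis
  proof (rule chord_colouring_constant[of r M s "\<lambda>i. P (c (2 * i))"])
    fix j
    have "c (2 * (j + M)) = c (2 * j)" by (simp add: c_eq_iff distrib_left)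
    then show "P (c (2 * (j + M))) = P (c (2 * j))" by simp
    show "P (c (2 * (j + s))) = P (c (2 * j))"
      by (rule ends[symmetric, of "map c [2 * j..2 * j + 2 * s]"])
         (use s gpath_arc[of "2 * j" "2 * j + 2 * s"] in \<open>auto simp: defs hdu distrib_left\<close>)
  next
    fix a b assume a: "0 \<le> a" "0 \<le> b" "a + b = s - 1" "s \<le> M - r - 1"
    show "P (c (2 * (- a))) = P (c (2 * (r + 1 + b)))"
      by (rule ends[of "map c [- 2 * a..0] @ map c [2 * r + 1..2 * r + 2 + 2 * b]"], rule gpath_chord[where ?a1.0 = "- 2 * a" and ?b1.0 = "0" and ?a2.0 = "2 * r + 1" and ?b2.0 = "2 * r + 2 + 2 * b"])
         (use s r a in \<open>auto simp: defs hdu algebra_simps nat_add_distrib[symmetric]\<close>)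
  next
    fix a b assume a: "0 \<le> a" "0 \<le> b" "a + b = s - 1" "s \<le> r"
    show "P (c (2 * a)) = P (c (2 * (r - b)))"
      by (rule ends[of "rev (map c [0..2 * a]) @ rev (map c [2 * r - 2 * b..2 * r + 1])"], rule gpath_chord[where ?a1.0 = "0" and ?b1.0 = "2 * a" and ?a2.0 = "2 * r - 2 * b" and ?b2.0 = "2 * r + 1"])
         (use s r a in \<open>auto simp: defs hdu algebra_simps nat_add_distrib[symmetric]\<close>)
  next
    fix a b assume a: "0 \<le> a" "0 \<le> b" "a + b = s - 1" "a \<le> M - r - 1" "b \<le> r - 1"
    show "P (c (2 * (- a))) = P (c (2 * (r - b)))"
      by (rule ends[of "map c [- 2 * a..0] @ rev (map c [2 * r - 2 * b..2 * r + 1])"], rule gpath_chord[where ?a1.0 = "- 2 * a" and ?b1.0 = "0" and ?a2.0 = "2 * r - 2 * b" and ?b2.0 = "2 * r + 1"])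
         (use s r a in \<open>auto simp: defs hdu algebra_simps nat_add_distrib[symmetric]\<close>)
  next
    fix a b assume a: "0 \<le> a" "0 \<le> b" "a + b = s - 1" "a \<le> r" "b \<le> M - r - 2"
    show "P (c (2 * a)) = P (c (2 * (r + 1 + b)))"
      by (rule ends[of "rev (map c [0..2 * a]) @ map c [2 * r + 1..2 * r + 2 + 2 * b]"], rule gpath_chord[where ?a1.0 = "0" and ?b1.0 = "2 * a" and ?a2.0 = "2 * r + 1" and ?b2.0 = "2 * r + 2 + 2 * b"])
         (use s r a in \<open>auto simp: defs hdu algebra_simps nat_add_distrib[symmetric]\<close>)
  qed (rule r s)+
qed

end

section \<open>Levels of a bipartite graph\<close>

locale bip_graph =
  fixes V :: "'a set" and E :: "'a \<Rightarrow> 'a \<Rightarrow> bool" and col :: "'a \<Rightarrow> bool"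
  assumes finite_V: "finite V"
    and E_sym: "E u v \<Longrightarrow> E v u"
    and E_V: "E u v \<Longrightarrow> u \<in> V"
    and E_col: "E u v \<Longrightarrow> col u \<noteq> col v"
begin

lemma E_V': "E u v \<Longrightarrow> v \<in> V"
  using E_sym E_V by blast

lemma gpath_col:
  assumes "gpath E ps" "t < length ps"
  shows "col (ps ! t) = (col (ps ! 0) = even t)"
  using assms(2)
proof (induction t)
  case (Suc t)
  then have "E (ps ! t) (ps ! Suc t)"
    using assms(1) by (auto simp: gpath_def successively_conv_nth)
  then show ?case using Suc E_col by (metis Suc_lessD even_Suc)
qed simp

end

locale rooted_bip_graph = bip_graph +
  fixes x :: 'a
  assumes x_V: "x \<in> V"
begin

text \<open>These are the balls around \<open>x\<close>; the levels are the spheres, obtained as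
  differences of consecutive balls.\<close>

primrec reach :: "nat \<Rightarrow> 'a set" where
  "reach 0 = {x}"
| "reach (Suc i) = reach i \<union> {v. \<exists>u\<in>reach i. E u v}"

definition level :: "nat \<Rightarrow> 'a set" where
  "level i = (case i of 0 \<Rightarrow> {x} | Suc j \<Rightarrow> reach (Suc j) - reach j)"

lemma level_0: "level 0 = {x}"
  and level_Suc: "level (Suc j) = reach (Suc j) - reach j"
  by (simp_all add: level_def)

lemma reach_mono: "i \<le> j \<Longrightarrow> reach i \<subseteq> reach j"
  by (rule lift_Suc_mono_le) auto

lemma level_subset_reach: "level i \<subseteq> reach i"
  by (cases i) (auto simp: level_0 level_Suc)

lemma reach_subset_V: "reach i \<subseteq> V"
  by (induction i) (use x_V E_V' in auto)

lemma level_subset_V: "level i \<subseteq> V"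
  using level_subset_reach reach_subset_V by blast

lemma finite_level: "finite (level i)"
  using level_subset_V finite_V finite_subset by blast

lemma level_not_reach:
  assumes "v \<in> level j" "i < j"
  shows "v \<notin> reach i"
  using assms reach_mono[of i "j - 1"] by (cases j) (auto simp: level_Suc)

lemma level_unique:
  assumes "v \<in> level i" "v \<in> level j"
  shows "i = j"
  using assms level_not_reach level_subset_reach by (metis linorder_neqE_nat subsetD)

lemma level_parent:
  assumes "v \<in> level (Suc i)"
  shows "\<exists>u\<in>level i. E v u"
proof -
  obtain u where u: "u \<in> reach i" "E u v" using assms by (auto simp: level_Suc)
  have "u \<in> level i"
  proof (cases i)
    case (Suc j)
    then have "u \<notin> reach j" using u assms by (auto simp: level_Suc)
    then show ?thesis using u Suc by (simp add: level_Suc)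
  qed (use u in \<open>simp add: level_0\<close>)
  then show ?thesis using u E_sym by blast
qed

lemma level_col: "v \<in> level i \<Longrightarrow> col v = (col x = even i)"
proof (induction i arbitrary: v)
  case (Suc i)
  then obtain u where "u \<in> level i" "E v u" using level_parent by blast
  then show ?case using Suc.IH E_col by fastforce
qed (simp add: level_0)

lemma reach_level:
  assumes "v \<in> reach i"
  shows "\<exists>j\<le>i. v \<in> level j"
  using assms
proof (induction i)
  case (Suc i)
  show ?case
  proof (cases "v \<in> reach i")
    case True
    then show ?thesis using Suc.IH le_Suc_eq by blast
  next
    case False
    then have "v \<in> level (Suc i)" using Suc.prems by (simp add: level_Suc)
    then show ?thesis by blast
  qed
qed (simp add: level_0)

text \<open>An edge changes the distance from \<open>x\<close> by at most one, and the levels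
  alternate in colour, so an edge inside a level is impossible.\<close>

lemma level_neighbour:
  assumes "u \<in> level i" "E u v"
  shows "v \<in> level (Suc i) \<or> (\<exists>j. i = Suc j \<and> v \<in> level j)"
proof -
  have "v \<in> reach (Suc i)" using assms level_subset_reach by auto
  then obtain j where j: "j \<le> Suc i" "v \<in> level j" using reach_level by blast
  have "v \<in> reach j" using j level_subset_reach by blast
  then have "u \<in> reach (Suc j)" using assms E_sym by auto
  then have "i \<le> Suc j" using level_not_reach[OF assms(1)] by (meson not_le)
  moreover have "i \<noteq> j" using level_col[OF assms(1)] level_col[OF j(2)] E_col[OF assms(2)] by auto
  ultimately have "j = Suc i \<or> i = Suc j" using j by auto
  then show ?thesis using j by auto
qed

end

section \<open>Closing a theta graph to a cycle of length 2k\<close>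

locale even_cycle_free = rooted_bip_graph +
  fixes k :: nat
  assumes k: "k \<ge> 2"
    and no_cycle: "\<lbrakk>gpath E ps; length ps = 2 * k\<rbrakk> \<Longrightarrow> \<not> E (last ps) (hd ps)"
begin

text \<open>The cycle is listed starting from an end of the chord. The bounds on \<open>a\<close>
  exclude the two cycle neighbours of the head.\<close>

definition theta :: "'a list \<Rightarrow> bool" where
  "theta qs \<longleftrightarrow> gpath E qs \<and> 2 * k \<le> length qs \<and> E (hd qs) (last qs)
     \<and> (\<exists>a. 1 < a \<and> Suc a < length qs \<and> E (qs ! 0) (qs ! a))"

text \<open>The ends of the chord have different colours, so numbering the cycle from a suitable end
  puts the prescribed colour \<open>b\<close> on the even indices. Changing the end replaces
  \<open>r\<close> by \<open>M - r - 1\<close>.\<close>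

lemma theta_chorded_cycle:
  assumes "theta qs"
  obtains c M r where "chorded_cycle E c M r" "range c = set qs" "length qs = nat (2 * M)"
    "range (\<lambda>j. c (2 * j)) = {v \<in> set qs. col v = b}"
proof -
  define N where "N = length qs"
  from assms obtain a where path: "gpath E qs" and N: "2 * k \<le> N" and closed: "E (hd qs) (last qs)"
    and a: "1 < a" "Suc a < N" "E (qs ! 0) (qs ! a)"
    by (auto simp: theta_def N_def)
  have qs: "qs \<noteq> []" "distinct qs" "successively E qs" using path by (auto simp: gpath_def)
  have ends: "hd qs = qs ! 0" "last qs = qs ! (N - 1)"
    using qs by (simp_all add: hd_conv_nth last_conv_nth N_def)
  have colt: "col (qs ! t) = (col (qs ! 0) = even t)" if "t < N" for t
    using gpath_col[OF path] that by (simp add: N_def)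
  have "odd (N - 1)" using colt[of "N - 1"] E_col[OF closed] a ends by auto
  then have "even N" using a by auto
  have "odd a" using colt[of a] E_col[OF a(3)] a by auto
  define M r where "M = int N div 2" and "r = int a div 2"
  have M: "2 * M = int N" and r: "2 * r + 1 = int a"
    using \<open>even N\<close> \<open>odd a\<close> by (auto simp: M_def r_def)
  define c where "c j = qs ! nat (j mod (2 * M))" for j
  have mod: "nat (j mod (2 * M)) < N" for j using M a by (simp add: nat_less_iff)
  have c_eq: "c i = c j \<longleftrightarrow> i mod (2 * M) = j mod (2 * M)" for i j
    using nth_eq_iff_index_eq[OF qs(2)] mod[of i] mod[of j] M a unfolding c_def N_def[symmetric]
    by (auto simp: nat_eq_iff2)
  have c_int: "c (int t) = qs ! t" if "t < N" for t
    unfolding c_def M using that by simp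
  have range_c: "range c = set qs"
  proof
    show "range c \<subseteq> set qs" using mod by (auto simp: c_def N_def)
    show "set qs \<subseteq> range c"
    proof
      fix v assume "v \<in> set qs"
      then obtain t where "t < N" "v = qs ! t" by (auto simp: in_set_conv_nth N_def)
      then show "v \<in> range c" using c_int[of t] by (metis rangeI)
    qed
  qed
  have edge: "E (c j) (c (j + 1))" for j
  proof -
    define t where "t = nat (j mod (2 * M))"
    have t: "int t = j mod (2 * M)" using M a by (simp add: t_def)
    have ct: "c j = c (int t)" "c (j + 1) = c (int t + 1)"
      unfolding c_eq t by (simp_all add: mod_add_left_eq)
    have tN: "t < N" using mod[of j] by (simp add: t_def)
    show ?thesis
    proof (cases "Suc t < N")
      case True
      then show ?thesis using qs(3) c_int[of t] c_int[of "Suc t"] tN unfolding ct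
        by (auto simp: successively_conv_nth N_def ac_simps)
    next
      case False
      then have "t = N - 1" using tN by auto
      then have "int t + 1 = 2 * M" using M a by auto
      then have "c (int t + 1) = c (int 0)" unfolding c_eq by simp
      then show ?thesis using ends closed c_int[of 0] c_int[of t] E_sym tN a \<open>t = N - 1\<close>
        unfolding ct by auto
    qed
  qed
  have colc: "col (c j) = (col (c 0) = even j)" for j
  proof -
    have "even (nat (j mod (2 * M))) = even (j mod (2 * M))" using M a
      by (simp add: even_nat_iff)
    also have "\<dots> = even j" by (simp add: even_mod_2_iff mod_mult2_eq dvd_mod_iff)
    finally show ?thesis using colt[OF mod[of j]] by (simp add: c_def)
  qed
  have chord: "E (c 0) (c (2 * r + 1))"
    using c_int[of 0] c_int[of a] a r by simp
  have r_bounds: "1 \<le> r" "r \<le> M - 2"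
    using a M r by linarith+
  show ?thesis
  proof (cases "col (c 0) = b")
    case True
    have colb: "col (c j) = (b = even j)" for j using True colc[of j] by auto
    have "range (\<lambda>j. c (2 * j)) = {v \<in> range c. col v = b}"
    proof (intro set_eqI iffI)
      fix v assume "v \<in> {v \<in> range c. col v = b}"
      then obtain j where j: "v = c j" "col v = b" by blast
      then have "even j" using colb[of j] by auto
      from this obtain i where "j = 2 * i" by (rule evenE)
      then have "v = c (2 * i)" using j(1) by simp
      then show "v \<in> range (\<lambda>j. c (2 * j))" by (rule range_eqI)
    next
      fix v assume "v \<in> range (\<lambda>j. c (2 * j))"
      then obtain j where "v = c (2 * j)" by blast
      then show "v \<in> {v \<in> range c. col v = b}" using colb[of "2 * j"] by simp
    qed
    moreover have "chorded_cycle E c M r"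
      by unfold_locales (use E_sym c_eq edge chord r_bounds in auto)
    ultimately show ?thesis using that range_c M N_def by auto
  next
    case False
    define c' where "c' j = c (j + 2 * r + 1)" for j
    have surj: "\<exists>i. c j = c' i" for j unfolding c'_def by (rule exI[of _ "j - 2 * r - 1"]) simp
    have rc': "range c' = range c"
      using surj by (auto simp: c'_def)
    have colc': "col (c' j) = (b = even j)" for j
      using False colc[of "j + 2 * r + 1"] by (auto simp: c'_def)
    have "range (\<lambda>j. c' (2 * j)) = {v \<in> range c'. col v = b}"
    proof (intro set_eqI iffI)
      fix v assume "v \<in> {v \<in> range c'. col v = b}"
      then obtain j where j: "v = c' j" "col v = b" by blast
      then have "even j" using colc'[of j] by auto
      from this obtain i where "j = 2 * i" by (rule evenE)
      then have "v = c' (2 * i)" using j(1) by simp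
      then show "v \<in> range (\<lambda>j. c' (2 * j))" by (rule range_eqI)
    next
      fix v assume "v \<in> range (\<lambda>j. c' (2 * j))"
      then obtain j where "v = c' (2 * j)" by blast
      then show "v \<in> {v \<in> range c'. col v = b}" using colc'[of "2 * j"] by simp
    qed
    moreover have "chorded_cycle E c' M (M - r - 1)"
    proof
      show "c' i = c' j \<longleftrightarrow> i mod (2 * M) = j mod (2 * M)" for i j
        by (simp add: c'_def c_eq mod_eq_dvd_iff)
      show "E (c' j) (c' (j + 1))" for j
        using edge[of "j + 2 * r + 1"] by (simp add: c'_def algebra_simps)
      have "c' (2 * (M - r - 1) + 1) = c 0" by (simp add: c'_def c_eq algebra_simps)
      then show "E (c' 0) (c' (2 * (M - r - 1) + 1))" using chord E_sym by (simp add: c'_def)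
    qed (use E_sym r_bounds in auto)
    ultimately show ?thesis using that range_c rc' M N_def by auto
  qed
qed

text \<open>Let Y be the set of vertices of the theta graph on level i; it is one of its colour classes. Suppose
  that the tree paths upwards from Y, the first step of which leaves the theta graph, all meet after l
  steps and not earlier. Then a path of length 2k - 2l in the theta graph between vertices of Y with
  distinct (l-1)-st ancestors closes up to a cycle of length 2k.\<close>

lemma no_well_placed_theta:
  assumes i: "1 \<le> i" "i < k"
    and qs: "theta qs" "set qs \<subseteq> level (i - 1) \<union> level i \<union> level (Suc i)"
    and wp: "\<And>y. y \<in> set qs \<inter> level i \<Longrightarrow> \<exists>z\<in>level (i - 1) - set qs. E y z"
  shows False
proof -
  obtain c M r where cc: "chorded_cycle E c M r" and range_c: "range c = set qs"
    and len: "length qs = nat (2 * M)"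
    and even_c: "range (\<lambda>j. c (2 * j)) = {v \<in> set qs. col v = (col x = even i)}"
    by (rule theta_chorded_cycle[OF qs(1)])
  interpret chorded_cycle E c M r by (rule cc)
  define Y where "Y = set qs \<inter> level i"
  have Y_c: "Y = range (\<lambda>j. c (2 * j))"
  proof -
    have "col v = (col x = even i) \<longleftrightarrow> v \<in> level i" if v: "v \<in> set qs" for v
    proof -
      have "v \<in> level (i - 1) \<union> level i \<union> level (Suc i)" using v qs(2) by blast
      moreover have "even (i - 1) \<noteq> even i" using i by auto
      ultimately show ?thesis using level_col[of v i] level_col[of v "i - 1"] level_col[of v "Suc i"] by auto
    qed
    then show ?thesis unfolding even_c Y_def by auto
  qed
  have kM: "int k \<le> M" using qs(1) len by (auto simp: theta_def)
  \<comment> \<open>One parent map serves all vertices, so that ancestor chains never separate once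
    they have met. On \<open>Y\<close> the first step leaves the theta graph by assumption; all
    later ancestors lie above level \<open>i - 1\<close>, where the theta graph has no
    vertices.\<close>
  have "\<forall>v. \<exists>z. (v \<in> Y \<longrightarrow> z \<in> level (i - 1) - set qs \<and> E v z)
      \<and> (\<forall>j. v \<in> level (Suc j) \<longrightarrow> z \<in> level j \<and> E v z)"
  proof
    fix v
    show "\<exists>z. (v \<in> Y \<longrightarrow> z \<in> level (i - 1) - set qs \<and> E v z)
      \<and> (\<forall>j. v \<in> level (Suc j) \<longrightarrow> z \<in> level j \<and> E v z)"
    proof (cases "v \<in> Y")
      case True
      then obtain z where z: "z \<in> level (i - 1) - set qs" "E v z" using wp Y_def by blast
      have "j = i - 1" if "v \<in> level (Suc j)" for j
        using that True level_unique[of v i "Suc j"] by (auto simp: Y_def)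
      then show ?thesis using z by blast
    next
      case False
      show ?thesis
      proof (cases "\<exists>j. v \<in> level (Suc j)")
        case True
        then obtain j where j: "v \<in> level (Suc j)" by blast
        then obtain z where "z \<in> level j" "E v z" using level_parent by blast
        then show ?thesis using False j level_unique[of v "Suc j"] by (metis Suc_inject)
      qed (use False in auto)
    qed
  qed
  then obtain par where par_Y: "\<And>v. v \<in> Y \<Longrightarrow> par v \<notin> set qs"
    and par: "\<And>v j. v \<in> level (Suc j) \<Longrightarrow> par v \<in> level j \<and> E v (par v)"
    by (metis DiffD2)
  define anc where "anc t y = (par ^^ t) y" for t y
  have anc_0: "anc 0 y = y" and anc_Suc: "anc (Suc t) y = par (anc t y)" for t y
    by (simp_all add: anc_def)
  have anc_level: "anc t y \<in> level (i - t)" if "y \<in> Y" "t \<le> i" for t y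
    using that(2)
  proof (induction t)
    case (Suc t)
    then have "anc t y \<in> level (Suc (i - Suc t))" by (simp add: Suc_diff_Suc)
    then show ?case using par by (simp add: anc_Suc)
  qed (use that in \<open>simp add: anc_0 Y_def\<close>)
  have anc_edge: "E (anc t y) (anc (Suc t) y)" if "y \<in> Y" "t < i" for t y
  proof -
    have "anc t y \<in> level (Suc (i - Suc t))" using anc_level[of y t] that by (simp add: Suc_diff_Suc)
    then show ?thesis using par by (simp add: anc_Suc)
  qed
  have anc_out: "anc t y \<notin> set qs" if "y \<in> Y" "1 \<le> t" "t \<le> i" for t y
  proof (cases "t = 1")
    case True
    then show ?thesis using par_Y that by (simp add: anc_0 anc_Suc)
  next
    case False
    then have "i - t \<noteq> i - 1" "i - t \<noteq> i" "i - t \<noteq> Suc i" using that by auto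
    then show ?thesis using anc_level[OF that(1,3)] level_unique[of "anc t y" "i - t"] qs(2) by blast
  qed
  define l where "l = (LEAST t. \<forall>y\<in>Y. \<forall>y'\<in>Y. anc t y = anc t y')"
  have all_i: "\<forall>y\<in>Y. \<forall>y'\<in>Y. anc i y = anc i y'"
    using anc_level[of _ i] by (auto simp: level_0)
  have l_i: "l \<le> i" unfolding l_def by (rule Least_le) (rule all_i)
  have l_eq: "anc l y = anc l y'" if "y \<in> Y" "y' \<in> Y" for y y'
    using LeastI[where P = "\<lambda>t. \<forall>y\<in>Y. \<forall>y'\<in>Y. anc t y = anc t y'", OF all_i] that
    unfolding l_def by blast
  have "l \<noteq> 0"
  proof
    assume "l = 0"
    moreover have "c (2 * 0) \<in> Y" "c (2 * 1) \<in> Y" unfolding Y_c by blast+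
    ultimately have "c (2 * 0) = c (2 * 1)" using l_eq[of "c (2 * 0)" "c (2 * 1)"] by (simp add: anc_0)
    then show False using r by (simp add: c_eq_iff)
  qed
  then have "l - 1 < l" by simp
  then have "\<not> (\<forall>y\<in>Y. \<forall>y'\<in>Y. anc (l - 1) y = anc (l - 1) y')"
    unfolding l_def by (rule not_less_Least)
  then obtain y0 y1 where y: "y0 \<in> Y" "y1 \<in> Y" "anc (l - 1) y0 \<noteq> anc (l - 1) y1" by blast
  then obtain j0 j1 where j01: "y0 = c (2 * j0)" "y1 = c (2 * j1)" using Y_c by auto
  \<comment> \<open>Otherwise the property of sharing the ancestor \<open>anc (l - 1)\<close> with
    \<open>y0\<close> would be constant on \<open>Y\<close> by
    \<open>even_path_colour_constant\<close> with \<open>s = k - l\<close>, although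
    \<open>y1\<close> lacks it. The bounds on \<open>s\<close> come from \<open>1 \<le> l\<close>,
    \<open>l \<le> i\<close>, \<open>i < k\<close> and \<open>k \<le> M\<close>.\<close>
  have "\<exists>ps. gpath E ps \<and> length ps = nat (2 * int (k - l) + 1) \<and> set ps \<subseteq> range c \<and>
      hd ps \<in> range (\<lambda>i. c (2 * i)) \<and> last ps \<in> range (\<lambda>i. c (2 * i)) \<and>
      (anc (l - 1) (hd ps) = anc (l - 1) y0) \<noteq> (anc (l - 1) (last ps) = anc (l - 1) y0)"
  proof (rule ccontr)
    assume no: "\<not> ?thesis"
    have "(anc (l - 1) (c (2 * j0)) = anc (l - 1) y0) = (anc (l - 1) (c (2 * j1)) = anc (l - 1) y0)"
      by (rule even_path_colour_constant[of "int (k - l)" "\<lambda>v. anc (l - 1) v = anc (l - 1) y0"])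
         (use no kM l_i i \<open>l \<noteq> 0\<close> in auto)
    then show False using y j01 by auto
  qed
  moreover have "nat (2 * int (k - l) + 1) = 2 * (k - l) + 1" by simp
  ultimately obtain ps where ps: "gpath E ps" "length ps = 2 * (k - l) + 1" "set ps \<subseteq> set qs"
    and ends: "hd ps \<in> Y" "last ps \<in> Y" "anc (l - 1) (hd ps) \<noteq> anc (l - 1) (last ps)"
    unfolding range_c Y_c[symmetric] by metis
  define a b where "a = hd ps" and "b = last ps"
  have ab: "a \<in> Y" "b \<in> Y" using ends by (auto simp: a_def b_def)
  have anc_ne: "anc t a \<noteq> anc t b" if "t < l" for t
  proof
    assume "anc t a = anc t b"
    then have "anc (t + d) a = anc (t + d) b" for d by (induction d) (auto simp: anc_Suc)
    from this[of "l - 1 - t"] show False using ends that by (simp add: a_def b_def)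
  qed
  have anc_inj: "s = t" if "anc s y = anc t y'" "y \<in> Y" "y' \<in> Y" "s \<le> i" "t \<le> i" for s t y y'
    using anc_level[OF that(2,4)] anc_level[OF that(3,5)] that(1) level_unique[of "anc s y" "i - s" "i - t"] that
    by auto
  \<comment> \<open>\<open>xs\<close> climbs from \<open>b\<close> and stops just below the common
    ancestor, which belongs to \<open>ys\<close>, the descent to \<open>a\<close>. The numbers of
    vertices add up to \<open>2 * (k - l) + 1 + (l - 1) + l = 2 * k\<close>.\<close>
  define xs where "xs = map (\<lambda>t. anc t b) [1..<l]"
  define ys where "ys = rev (map (\<lambda>t. anc t a) [1..<Suc l])"
  have ys_ends: "ys \<noteq> []" "hd ys = anc l a" "last ys = anc 1 a"
  proof -
    show "ys \<noteq> []" "hd ys = anc l a" using \<open>l \<noteq> 0\<close> by (simp_all add: ys_def)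
    have "[1..<Suc l] = 1 # [Suc 1..<Suc l]" using \<open>l \<noteq> 0\<close> by (simp add: upt_conv_Cons del: upt_Suc)
    then show "last ys = anc 1 a" by (simp add: ys_def del: upt_Suc)
  qed
  have set_xs: "set xs = (\<lambda>t. anc t b) ` {1..<l}" and set_ys: "set ys = (\<lambda>t. anc t a) ` {1..<Suc l}"
    by (auto simp: xs_def ys_def simp del: upt_Suc)
  have "gpath E (ps @ xs @ ys)"
    unfolding gpath_def
  proof (intro conjI)
    show "ps @ xs @ ys \<noteq> []" using ys_ends by simp
    have "distinct xs" "distinct ys"
      using anc_inj[OF _ ab(2) ab(2)] anc_inj[OF _ ab(1) ab(1)] l_i
      by (auto simp: xs_def ys_def distinct_map inj_on_def simp del: upt_Suc)
    moreover have "set xs \<inter> set ys = {}"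
    proof -
      have "anc s b \<noteq> anc t a" if "s < l" "t \<le> l" for s t
        using anc_inj[OF _ ab(2) ab(1), of s t] anc_ne[of s] that l_i by auto
      then show ?thesis by (force simp: set_xs set_ys)
    qed
    moreover have "set ps \<inter> set xs = {}" "set ps \<inter> set ys = {}"
      using anc_out ps(3) ab l_i by (fastforce simp: set_xs set_ys)+
    ultimately show "distinct (ps @ xs @ ys)" using ps(1) by (auto simp: gpath_def)
    have sx: "successively E xs" using anc_edge[OF ab(2)] l_i
      by (auto simp: xs_def successively_conv_nth)
    have "successively E (map (\<lambda>t. anc t a) [1..<Suc l])" using anc_edge[OF ab(1)] l_i
      by (auto simp: successively_conv_nth simp del: upt_Suc)
    then have sy: "successively E ys" using E_sym unfolding ys_def successively_rev
      by (rule successively_mono)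
    have lb: "E (anc (l - 1) b) (anc l a)"
      using anc_edge[OF ab(2), of "l - 1"] l_eq[OF ab] l_i \<open>l \<noteq> 0\<close> by simp
    show "successively E (ps @ xs @ ys)"
    proof (cases "l = 1")
      case True
      then have "xs = []" by (simp add: xs_def)
      then show ?thesis using ps(1) sy ys_ends lb True
        by (auto simp: gpath_def successively_append_iff anc_0 b_def)
    next
      case False
      then have "xs \<noteq> []" "hd xs = anc 1 b" "last xs = anc (l - 1) b"
        using \<open>l \<noteq> 0\<close> by (auto simp: xs_def hd_map last_map)
      moreover have "E b (anc 1 b)" using anc_edge[OF ab(2), of 0] i by (simp add: anc_0)
      ultimately show ?thesis using ps(1) sx sy ys_ends lb
        by (auto simp: gpath_def successively_append_iff b_def)
    qed
  qed
  moreover have "length (ps @ xs @ ys) = 2 * k"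
    using ps(2) l_i i \<open>l \<noteq> 0\<close> by (simp add: xs_def ys_def)
  moreover have "E (last (ps @ xs @ ys)) (hd (ps @ xs @ ys))"
  proof -
    have "E (anc 1 a) a" using anc_edge[OF ab(1), of 0] i E_sym by (simp add: anc_0)
    then show ?thesis using ys_ends ps(1) by (auto simp: gpath_def a_def)
  qed
  ultimately show False using no_cycle by blast
qed

end

section \<open>Edges between consecutive levels\<close>

context bip_graph
begin

definition nb :: "'a \<Rightarrow> 'a set \<Rightarrow> 'a set" where
  "nb u X = {v \<in> X. E u v}"

definition ec :: "'a set \<Rightarrow> 'a set \<Rightarrow> nat" where
  "ec X Y = (\<Sum>u\<in>X. card (nb u Y))"

lemma finite_nb: "finite X \<Longrightarrow> finite (nb u X)"
  by (simp add: nb_def)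

lemma nb_subset: "nb u X \<subseteq> X"
  by (auto simp: nb_def)

lemma card_nb_mono: "finite Y \<Longrightarrow> X \<subseteq> Y \<Longrightarrow> card (nb u X) \<le> card (nb u Y)"
  by (rule card_mono) (auto simp: nb_def)

lemma card_nb_Un:
  assumes "finite X" "finite Y" "X \<inter> Y = {}"
  shows "card (nb u (X \<union> Y)) = card (nb u X) + card (nb u Y)"
proof -
  have "nb u (X \<union> Y) = nb u X \<union> nb u Y" by (auto simp: nb_def)
  moreover have "nb u X \<inter> nb u Y = {}" using assms by (auto simp: nb_def)
  ultimately show ?thesis using assms by (simp add: finite_nb card_Un_disjoint)
qed

lemma ec_commute:
  assumes "finite X" "finite Y"
  shows "ec X Y = ec Y X"
proof -
  have E_iff: "E u v = E v u" for u v using E_sym by blast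
  have "(\<Sum>u\<in>X. card (nb u Y)) = (\<Sum>u\<in>X. \<Sum>v\<in>Y. of_bool (E u v))"
    using assms by (simp add: nb_def Int_def)
  also have "\<dots> = (\<Sum>v\<in>Y. \<Sum>u\<in>X. of_bool (E v u))"
    unfolding sum.swap[of _ Y] by (simp only: E_iff)
  also have "\<dots> = (\<Sum>v\<in>Y. card (nb v X))"
    using assms by (simp add: nb_def Int_def)
  finally show ?thesis by (simp add: ec_def)
qed

lemma ec_remove:
  assumes "finite X" "u \<in> X"
  shows "ec X Y = card (nb u Y) + ec (X - {u}) Y"
  using assms by (simp add: ec_def sum.remove)

lemma ec_Un_right:
  assumes "finite Y" "finite Z" "Y \<inter> Z = {}"
  shows "ec X (Y \<union> Z) = ec X Y + ec X Z"
  using assms by (simp add: ec_def card_nb_Un sum.distrib)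

lemma ec_split_right:
  assumes "finite Y" "Z \<subseteq> Y"
  shows "ec X Y = ec X Z + ec X (Y - Z)"
proof -
  have "Y = Z \<union> (Y - Z)" using assms by auto
  then show ?thesis using ec_Un_right[of Z "Y - Z" X] assms finite_subset by (metis Diff_disjoint finite_Diff)
qed

lemma ec_le_mult:
  assumes "\<And>u. u \<in> X \<Longrightarrow> card (nb u Y) \<le> d"
  shows "ec X Y \<le> d * card X"
  using sum_bounded_above[of X "\<lambda>u. card (nb u Y)" d] assms by (simp add: ec_def mult.commute)

lemma ec_ge_mult:
  fixes d :: real
  assumes "\<And>u. u \<in> X \<Longrightarrow> d \<le> card (nb u Y)"
  shows "d * card X \<le> ec X Y"
  using sum_bounded_below[of X d "\<lambda>u. real (card (nb u Y))"] assms by (simp add: ec_def mult.commute)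

lemma gpath_longest:
  assumes "finite W" "v \<in> W"
  obtains ps where "gpath E ps" "set ps \<subseteq> W"
    "\<And>qs. \<lbrakk>gpath E qs; set qs \<subseteq> W\<rbrakk> \<Longrightarrow> length qs \<le> length ps"
proof -
  have "gpath E [v] \<and> set [v] \<subseteq> W" using assms by (simp add: gpath_def)
  moreover have "\<forall>qs. gpath E qs \<and> set qs \<subseteq> W \<longrightarrow> length qs < Suc (card W)"
    using assms card_mono distinct_card unfolding gpath_def by (metis le_imp_less_Suc)
  ultimately show ?thesis
    using ex_has_greatest_nat[of "\<lambda>qs. gpath E qs \<and> set qs \<subseteq> W" "[v]" length "Suc (card W)"] that by blast
qed

end

context even_cycle_free
begin

text \<open>The farther of two neighbours of the head closes the cycle, and the edge to the nearer
  one is the chord.\<close>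

lemma theta_take:
  assumes "gpath E ps" "1 < a" "a < b" "b < length ps" "2 * k - 1 \<le> b"
    and "E (ps ! 0) (ps ! a)" "E (ps ! 0) (ps ! b)"
  shows "theta (take (Suc b) ps)"
proof -
  have "gpath E (take (Suc b) ps)"
    using assms by (auto simp: gpath_def successively_conv_nth)
  moreover have "hd (take (Suc b) ps) = ps ! 0" "last (take (Suc b) ps) = ps ! b"
    using assms by (simp_all add: gpath_def hd_conv_nth take_Suc_conv_app_nth nth_append)
  ultimately show ?thesis
    using assms unfolding theta_def by (auto intro!: exI[of _ a])
qed

text \<open>Among more than 2k positions the largest is above 2k, hence the cycle is long enough. As
  \<open>2 * k\<close> is at least 4, some position other than 1 and the largest remains for the
  chord.\<close>

lemma theta_head:
  assumes "gpath E ps" "2 * k < card (nb (hd ps) (set ps))"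
  obtains b where "theta (take b ps)"
proof -
  define J where "J = {j. j < length ps \<and> E (ps ! 0) (ps ! j)}"
  have ps: "ps \<noteq> []" "distinct ps" using assms(1) by (auto simp: gpath_def)
  have "nb (hd ps) (set ps) = (!) ps ` J"
    using ps by (auto simp: nb_def J_def in_set_conv_nth hd_conv_nth)
  then have "card (nb (hd ps) (set ps)) \<le> card J"
    by (simp add: J_def card_image_le)
  then have J: "2 * k < card J" "finite J" using assms by (auto simp: J_def)
  define b where "b = Max J"
  have b: "b \<in> J" using J by (auto simp: b_def intro!: Max_in)
  have "0 \<notin> J" using E_col by (auto simp: J_def)
  then have "1 \<le> j" if "j \<in> J" for j using that by (metis less_one not_le)
  then have "J \<subseteq> {1..b}" using J by (auto simp: b_def)
  then have "card J \<le> b" using card_mono[of "{1..b}" J] by simp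
  have "card {1, b} \<le> 2" by (simp add: card_insert_if)
  then have "\<not> J \<subseteq> {1, b}"
    using card_mono[of "{1, b}" J] J k by fastforce
  then obtain a where "a \<in> J" "a \<noteq> 1" "a \<noteq> b" by auto
  then have a: "a \<in> J" "1 < a" "a < b" using \<open>J \<subseteq> {1..b}\<close> by force+
  have "theta (take (Suc b) ps)"
    by (rule theta_take[OF assms(1) a(2,3)]) (use a b J \<open>card J \<le> b\<close> in \<open>auto simp: J_def\<close>)
  then show ?thesis by (rule that)
qed

lemma no_theta_level_pair:
  assumes i: "1 \<le> i" "i < k" and "set qs \<subseteq> level i \<union> level (Suc i)"
  shows "\<not> theta qs"
proof
  assume th: "theta qs"
  show False
  proof (rule no_well_placed_theta[OF i th])
    fix y assume "y \<in> set qs \<inter> level i"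
    then obtain z where z: "z \<in> level (i - 1)" "E y z" using level_parent[of y "i - 1"] i by auto
    have "z \<notin> level i \<union> level (Suc i)"
      using level_unique[OF z(1), of i] level_unique[OF z(1), of "Suc i"] i by auto
    then show "\<exists>z\<in>level (i - 1) - set qs. E y z" using z assms(3) by blast
  qed (use assms(3) in auto)
qed

text \<open>Deleting a vertex with at most 2k neighbours costs at most 2k edges. Once no such vertex
  is left, a longest path contains all neighbours of its head, more than 2k of them, and
  \<open>theta_head\<close> applies. Level 0 is treated apart, since
  \<open>no_theta_level_pair\<close> needs a level before it; there the edges form a star.\<close>

lemma ec_level_pair:
  assumes "i < k" "X \<subseteq> level i" "Y \<subseteq> level (Suc i)"
  shows "ec X Y \<le> 2 * k * (card X + card Y)"
proof (cases "i = 0")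
  case True
  have "finite Y" using assms finite_level finite_subset by blast
  then have "ec X Y \<le> card Y * card X"
    by (intro ec_le_mult card_mono nb_subset)
  also have "\<dots> \<le> card Y * 1"
    using assms True card_mono[of "{x}" X] by (intro mult_left_mono) (auto simp: level_0)
  also have "\<dots> \<le> 2 * k * (card X + card Y)"
    using k by (simp add: distrib_left trans_le_add2)
  finally show ?thesis .
next
  case False
  then have i: "1 \<le> i" by simp
  show ?thesis
    using assms(2,3)
  proof (induction "card X + card Y" arbitrary: X Y rule: less_induct)
    case less
    have fin: "finite X" "finite Y" using less.prems finite_level finite_subset by blast+
    consider (X) u where "u \<in> X" "card (nb u Y) \<le> 2 * k"
      | (Y) u where "u \<in> Y" "card (nb u X) \<le> 2 * k"
      | (no) "\<And>u. u \<in> X \<Longrightarrow> 2 * k < card (nb u Y)" "\<And>u. u \<in> Y \<Longrightarrow> 2 * k < card (nb u X)"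
      by (meson not_le)
    then show ?case
    proof cases
      case X
      then have c: "card X = Suc (card (X - {u}))" using fin card_Suc_Diff1 by metis
      then have "ec (X - {u}) Y \<le> 2 * k * (card (X - {u}) + card Y)"
        using less.prems by (intro less.hyps) (simp_all only: c, auto)
      moreover have "2 * k * (card X + card Y) = 2 * k + 2 * k * (card (X - {u}) + card Y)"
        unfolding c by (simp only: add_Suc mult_Suc_right)
      ultimately show ?thesis using ec_remove[OF fin(1) X(1), of Y] X(2) by linarith
    next
      case Y
      then have c: "card Y = Suc (card (Y - {u}))" using fin card_Suc_Diff1 by metis
      then have "ec X (Y - {u}) \<le> 2 * k * (card X + card (Y - {u}))"
        using less.prems by (intro less.hyps) (simp_all only: c, auto)
      moreover have "2 * k * (card X + card Y) = 2 * k + 2 * k * (card X + card (Y - {u}))"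
        unfolding c by (simp only: add_Suc_right mult_Suc_right)
      moreover have "ec X Y = ec Y X" "ec X (Y - {u}) = ec (Y - {u}) X"
        using fin by (simp_all add: ec_commute)
      ultimately show ?thesis using ec_remove[OF fin(2) Y(1), of X] Y(2) by linarith
    next
      case no
      have "X \<union> Y = {}"
      proof (rule ccontr)
        assume "X \<union> Y \<noteq> {}"
        then obtain v where "v \<in> X \<union> Y" by blast
        then obtain ps where ps: "gpath E ps" "set ps \<subseteq> X \<union> Y"
          and longest: "\<And>qs. \<lbrakk>gpath E qs; set qs \<subseteq> X \<union> Y\<rbrakk> \<Longrightarrow> length qs \<le> length ps"
          using gpath_longest[of "X \<union> Y" v] fin by blast
        define u where "u = hd ps"
        have "u \<in> X \<union> Y" using ps hd_in_set[of ps] unfolding u_def gpath_def by blast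
        then have "2 * k < card (nb u (X \<union> Y))"
        proof
          assume "u \<in> X"
          then show ?thesis
            using no(1)[of u] card_nb_mono[of "X \<union> Y" Y u] fin by simp
        next
          assume "u \<in> Y"
          then show ?thesis
            using no(2)[of u] card_nb_mono[of "X \<union> Y" X u] fin by simp
        qed
        also have "nb u (X \<union> Y) \<subseteq> nb u (set ps)"
        proof
          fix w assume w: "w \<in> nb u (X \<union> Y)"
          show "w \<in> nb u (set ps)"
          proof (rule ccontr)
            assume "w \<notin> nb u (set ps)"
            then have "gpath E (w # ps)" using ps w E_sym
              by (auto simp: gpath_def nb_def successively_Cons u_def)
            then show False using longest[of "w # ps"] w ps by (auto simp: nb_def)
          qed
        qed
        then have "card (nb u (X \<union> Y)) \<le> card (nb u (set ps))"
          by (intro card_mono) (auto simp: finite_nb)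
        finally obtain b where "theta (take b ps)" using theta_head[OF ps(1)] u_def by blast
        moreover have "set (take b ps) \<subseteq> level i \<union> level (Suc i)"
          using set_take_subset[of b ps] ps(2) less.prems by blast
        ultimately show False using no_theta_level_pair[OF i assms(1)] by blast
      qed
      then show ?thesis by (simp add: ec_def)
    qed
  qed
qed

end

section \<open>Growth of the levels under a minimum degree\<close>

locale dense_even_cycle_free = even_cycle_free +
  fixes dl :: real
  assumes min_degree: "u \<in> V \<Longrightarrow> dl \<le> card (nb u V)"
    and dl: "8 * real k \<le> dl"
begin

lemma nb_level_Suc:
  assumes "u \<in> level (Suc i)"
  shows "card (nb u V) = card (nb u (level i)) + card (nb u (level (Suc (Suc i))))"
proof -
  have "nb u V = nb u (level i \<union> level (Suc (Suc i)))"
    using level_neighbour[OF assms] level_subset_V by (auto simp: nb_def)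
  moreover have "level i \<inter> level (Suc (Suc i)) = {}"
    using level_unique[of _ i "Suc (Suc i)"] by auto
  ultimately show ?thesis by (simp add: card_nb_Un finite_level)
qed

lemma nb_root: "nb x V = level 1"
proof (intro set_eqI iffI)
  fix v assume "v \<in> nb x V"
  then show "v \<in> level 1" using level_neighbour[of x 0 v] by (simp add: level_0 nb_def)
next
  fix v assume v: "v \<in> level 1"
  then have "E v x" using level_parent[of v 0] by (simp add: level_0)
  then show "v \<in> nb x V" using v level_subset_V[of 1] E_sym by (auto simp: nb_def)
qed

text \<open>The three claims support each other in the induction: monotonicity bounds the edges back
  to the previous level by 4k per vertex, the remaining \<open>dl - 4 * k\<close> edges per vertex
  go forward, and \<open>ec_level_pair\<close> turns them into vertices at the cost of another 2k.
  Since \<open>dl \<ge> 8 * k\<close>, the sizes are again monotone.\<close>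

lemma level_growth:
  assumes "i < k"
  shows "(dl - 4 * k) * card (level i) \<le> ec (level i) (level (Suc i))
    \<and> (dl - 6 * k) * card (level i) \<le> 2 * k * card (level (Suc i))
    \<and> card (level i) \<le> card (level (Suc i))"
  using assms
proof (induction i)
  case 0
  have "nb x (level 1) = level 1" using nb_root by (auto simp: nb_def)
  then have eq: "ec (level 0) (level 1) = card (level 1)" by (simp add: level_0 ec_def)
  have "dl \<le> card (level 1)" using min_degree[OF x_V] nb_root by simp
  then have a: "dl - 4 * real k \<le> card (level 1)" "dl - 6 * real k \<le> card (level 1)" by simp_all
  have "1 * real (card (level 1)) \<le> (2 * real k) * real (card (level 1))"
    using k by (intro mult_right_mono) auto
  then have b: "dl - 6 * real k \<le> (2 * real k) * real (card (level 1))"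
    using a(2) unfolding mult_1 by (rule order_trans[rotated])
  have c1: "card (level 0) \<le> card (level 1)" using a(2) dl k
    by (cases "card (level 1) = 0") (auto simp: level_0)
  have c0: "real (card (level 0)) = 1" by (simp add: level_0)
  show ?case unfolding One_nat_def[symmetric] eq c0 of_nat_mult of_nat_numeral mult_1_right
    using a b c1 by blast
next
  case (Suc i)
  let ?c = "\<lambda>i. real (card (level i))"
  have IH: "?c i \<le> ?c (Suc i)" using Suc by simp
  have fin: "finite (level j)" for j by (rule finite_level)
  have "dl * ?c (Suc i) \<le> ec (level (Suc i)) V"
    using ec_ge_mult[of "level (Suc i)" dl V] min_degree level_subset_V by blast
  also have "ec (level (Suc i)) V = ec (level (Suc i)) (level i) + ec (level (Suc i)) (level (Suc (Suc i)))"
    by (simp add: ec_def nb_level_Suc sum.distrib)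
  finally have total: "dl * ?c (Suc i)
      \<le> real (ec (level (Suc i)) (level i)) + ec (level (Suc i)) (level (Suc (Suc i)))" by simp
  have "ec (level (Suc i)) (level i) \<le> 2 * k * (card (level i) + card (level (Suc i)))"
    using ec_level_pair[of i "level i" "level (Suc i)"] Suc.prems ec_commute[OF fin fin] by simp
  then have "real (ec (level (Suc i)) (level i)) \<le> real (2 * k * (card (level i) + card (level (Suc i))))"
    by (rule of_nat_mono)
  also have "\<dots> = 2 * k * (?c i + ?c (Suc i))" by simp
  also have "\<dots> \<le> 2 * k * (2 * ?c (Suc i))" using IH by (intro mult_left_mono) auto
  finally have fwd: "(dl - 4 * k) * ?c (Suc i) \<le> ec (level (Suc i)) (level (Suc (Suc i)))"
    using total by (simp add: algebra_simps)
  have "ec (level (Suc i)) (level (Suc (Suc i)))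
      \<le> 2 * k * (card (level (Suc i)) + card (level (Suc (Suc i))))"
    using ec_level_pair[OF Suc.prems] by simp
  then have "real (ec (level (Suc i)) (level (Suc (Suc i))))
      \<le> real (2 * k * (card (level (Suc i)) + card (level (Suc (Suc i)))))"
    by (rule of_nat_mono)
  then have grow: "(dl - 6 * k) * ?c (Suc i) \<le> 2 * k * ?c (Suc (Suc i))"
    using fwd by (simp add: algebra_simps)
  have "(2 * k) * ?c (Suc i) \<le> (dl - 6 * k) * ?c (Suc i)"
    using dl by (intro mult_right_mono) auto
  then have "(2 * k) * ?c (Suc i) \<le> (2 * k) * ?c (Suc (Suc i))" using grow by simp
  then have "?c (Suc i) \<le> ?c (Suc (Suc i))" using k by (simp add: mult_le_cancel_left)
  then show ?case using fwd grow by simp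
qed

end

section \<open>Three consecutive levels with large minimum degrees\<close>

text \<open>Cut into blocks of length \<open>g\<close> from the minimum on, the range contains at
  most one element of \<open>J\<close> per block.\<close>

lemma card_gap_set:
  fixes J :: "nat set"
  assumes "finite J" "J \<noteq> {}" "g > 0"
    and gap: "\<And>a b. \<lbrakk>a \<in> J; b \<in> J; a < b\<rbrakk> \<Longrightarrow> a + g \<le> b"
  shows "Min J + g * (card J - 1) \<le> Max J"
proof -
  define q where "q j = (j - Min J) div g" for j
  have "inj_on q J"
  proof (rule linorder_inj_onI)
    fix a b assume ab: "a < b" "a \<in> J" "b \<in> J"
    then have "a - Min J + g \<le> b - Min J" using gap[of a b] Min_le[OF assms(1)] by force
    then have "q a + 1 \<le> q b"
      unfolding q_def using assms(3) div_le_mono[of "a - Min J + g" "b - Min J" g] by simp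
    then show "q a \<noteq> q b" by simp
  qed (use linorder_class.linear in blast)
  moreover have "q ` J \<subseteq> {0..(Max J - Min J) div g}"
    using assms(1) by (auto simp: q_def intro!: div_le_mono diff_le_mono Max_ge)
  ultimately have "card J \<le> card {0..(Max J - Min J) div g}"
    by (intro card_inj_on_le) auto
  then have "card J - 1 \<le> (Max J - Min J) div g" by simp
  then have "g * (card J - 1) \<le> g * ((Max J - Min J) div g)" by simp
  also have "\<dots> \<le> Max J - Min J" by simp
  finally have "g * (card J - 1) \<le> Max J - Min J" .
  moreover have "Min J \<le> Max J" using assms(1,2) by simp
  ultimately show ?thesis by linarith
qed

text \<open>\<open>m\<close> gaps of length \<open>2 * D\<close> cover 2k positions.
  \<open>B\<close> exceeds \<open>m + 2\<close> neighbours on either side of a vertex of a theta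
  graph; \<open>C\<close> leaves room for half of the neighbours being spoiled and 2k more lying on
  the path; \<open>A\<close> does the same for the set \<open>bad\<close>. The upper bounds
  \<open>S * C\<close> and \<open>R\<close> on degrees control how fast \<open>bad\<close>
  grows.\<close>

locale trilayer = even_cycle_free +
  fixes i :: nat and X1 X2 X3 :: "'a set" and A B C S D m R :: nat
  assumes i: "1 \<le> i" "i < k"
    and X1: "X1 \<subseteq> level (i - 1)" and X2: "X2 \<subseteq> level i" and X3: "X3 \<subseteq> level (Suc i)"
    and deg12: "u \<in> X1 \<Longrightarrow> A \<le> card (nb u X2)"
    and deg21: "u \<in> X2 \<Longrightarrow> B \<le> card (nb u X1)"
    and deg23: "u \<in> X2 \<Longrightarrow> C \<le> card (nb u X3)"
    and deg23_le: "u \<in> X2 \<Longrightarrow> card (nb u X3) \<le> S * C"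
    and deg32: "u \<in> X3 \<Longrightarrow> Suc D \<le> card (nb u X2)"
    and deg32_le: "u \<in> X3 \<Longrightarrow> card (nb u X2) \<le> R"
    and D: "1 \<le> D" and m: "1 \<le> m" and Dm: "k \<le> D * m"
    and B: "2 * m + 5 \<le> B" and C: "4 * k < C"
    and A: "2 * k * (1 + 2 * R * S) ^ D + 2 * k < A"
begin

lemma fin: "finite X1" "finite X2" "finite X3"
  using X1 X2 X3 finite_level finite_subset by blast+

lemma disj: "X1 \<inter> X2 = {}" "X1 \<inter> X3 = {}" "X2 \<inter> X3 = {}"
proof -
  have "level a \<inter> level b = {}" if "a \<noteq> b" for a b
    using that level_unique[of _ a b] by blast
  then have "level (i - 1) \<inter> level i = {}" "level (i - 1) \<inter> level (Suc i) = {}" "level i \<inter> level (Suc i) = {}"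
    using i by simp_all
  then show "X1 \<inter> X2 = {}" "X1 \<inter> X3 = {}" "X2 \<inter> X3 = {}" using X1 X2 X3 by blast+
qed

definition good :: "'a list \<Rightarrow> bool" where
  "good ps \<longleftrightarrow> gpath E ps \<and> set ps \<subseteq> X1 \<union> X2 \<union> X3
    \<and> (\<forall>a b. a < b \<and> b < length ps \<and> ps ! a \<in> X1 \<and> ps ! b \<in> X1 \<longrightarrow> a + 2 * D \<le> b)"

lemma good_spacing:
  "\<lbrakk>good ps; a < b; b < length ps; ps ! a \<in> X1; ps ! b \<in> X1\<rbrakk> \<Longrightarrow> a + 2 * D \<le> b"
  by (auto simp: good_def)

lemma good_take:
  assumes "good ps" "0 < n"
  shows "good (take n ps)"
  unfolding good_def
proof (intro conjI allI impI)
  show "gpath E (take n ps)"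
    using assms by (auto simp: good_def gpath_def successively_conv_nth)
  show "set (take n ps) \<subseteq> X1 \<union> X2 \<union> X3"
    using assms(1) set_take_subset[of n ps] by (auto simp: good_def)
  fix a b assume "a < b \<and> b < length (take n ps) \<and> take n ps ! a \<in> X1 \<and> take n ps ! b \<in> X1"
  then show "a + 2 * D \<le> b" using good_spacing[OF assms(1), of a b] by force
qed

lemma good_drop:
  assumes "good ps" "n < length ps"
  shows "good (drop n ps)"
  unfolding good_def
proof (intro conjI allI impI)
  show "gpath E (drop n ps)"
    using assms by (auto simp: good_def gpath_def successively_conv_nth)
  show "set (drop n ps) \<subseteq> X1 \<union> X2 \<union> X3"
    using assms(1) set_drop_subset[of n ps] by (auto simp: good_def)
  fix a b assume "a < b \<and> b < length (drop n ps) \<and> drop n ps ! a \<in> X1 \<and> drop n ps ! b \<in> X1"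
  then show "a + 2 * D \<le> b" using good_spacing[OF assms(1), of "n + a" "n + b"] assms(2) by (force simp: less_diff_conv add.commute)
qed

lemma good_rev:
  assumes "good ps"
  shows "good (rev ps)"
  unfolding good_def
proof (intro conjI allI impI)
  show "gpath E (rev ps)"
    using assms gpath_rev[of E ps] E_sym by (simp add: good_def)
  show "set (rev ps) \<subseteq> X1 \<union> X2 \<union> X3"
    using assms by (auto simp: good_def)
  fix a b assume "a < b \<and> b < length (rev ps) \<and> rev ps ! a \<in> X1 \<and> rev ps ! b \<in> X1"
  then show "a + 2 * D \<le> b"
    using good_spacing[OF assms, of "length ps - Suc b" "length ps - Suc a"] by (force simp: rev_nth)
qed

lemma good_Cons:
  assumes "good ps" "u \<in> X2 \<union> X3" "u \<notin> set ps" "E u (hd ps)"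
  shows "good (u # ps)"
  unfolding good_def
proof (intro conjI allI impI)
  show "gpath E (u # ps)"
    using assms by (auto simp: good_def gpath_def successively_Cons)
  show "set (u # ps) \<subseteq> X1 \<union> X2 \<union> X3"
    using assms by (auto simp: good_def)
  fix a b assume ab: "a < b \<and> b < length (u # ps) \<and> (u # ps) ! a \<in> X1 \<and> (u # ps) ! b \<in> X1"
  have "a \<noteq> 0" using ab assms(2) disj by (cases a) auto
  then show "a + 2 * D \<le> b"
    using good_spacing[OF assms(1), of "a - 1" "b - 1"] ab by (cases a; cases b) auto
qed

text \<open>Vertices of X1 are so far apart on a good path that the second last of m + 3 neighbours in X1 is
  at distance at least 2k. Omitting the last one makes the theta graph strictly shorter than the path.\<close>

lemma shorter_theta:
  assumes "good ps" "t < length ps"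
    and J: "J = {j. t < j \<and> j < length ps \<and> ps ! j \<in> X1 \<and> E (ps ! t) (ps ! j)}" "m + 3 \<le> card J"
  shows "\<exists>rs. good rs \<and> theta rs \<and> length rs < length ps"
proof -
  have finJ: "finite J" unfolding J(1) by simp
  have "J \<noteq> {}" using J(2) by auto
  then have MaxJ: "Max J \<in> J" using finJ by simp
  define J' where "J' = J - {Max J}"
  have cJ': "m + 2 \<le> card J'" using J(2) MaxJ finJ by (simp add: J'_def)
  then have J': "finite J'" "J' \<noteq> {}" using finJ m by (force simp: J'_def)+
  define b c where "b = Max J'" and "c = Min J'"
  have bc: "b \<in> J'" "c \<in> J'" using J' by (simp_all add: b_def c_def)
  have "c + 2 * D * (card J' - 1) \<le> b"
    unfolding b_def c_def
  proof (rule card_gap_set[OF J'])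
    fix a b assume "a \<in> J'" "b \<in> J'" "a < b"
    then show "a + 2 * D \<le> b" using good_spacing[OF assms(1), of a b] by (auto simp: J'_def J(1))
  qed (use D in simp)
  moreover have "2 * k \<le> 2 * D * (card J' - 1)"
  proof -
    have "2 * k \<le> 2 * D * m" using Dm by simp
    also have "\<dots> \<le> 2 * D * (card J' - 1)" using cJ' by (intro mult_left_mono) auto
    finally show ?thesis .
  qed
  ultimately have cb: "c + 2 * k \<le> b" by linarith
  have tc: "t < c" using bc by (simp add: J'_def J(1))
  have "card {b, c} \<le> 2" by (simp add: card_insert_if)
  then have "\<not> J' \<subseteq> {b, c}" using card_mono[of "{b, c}" J'] cJ' m by fastforce
  then obtain a where a: "a \<in> J'" "a \<noteq> b" "a \<noteq> c" by auto
  then have cab: "c < a" "a < b"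
    using Max_ge[OF J'(1) a(1)] Min_le[OF J'(1) a(1)] unfolding b_def c_def by linarith+
  have "b \<noteq> Max J" "b \<in> J" using bc(1) by (auto simp: J'_def)
  then have b_len: "Suc b < length ps"
  proof -
    have "b < Max J" using Max_ge[OF finJ \<open>b \<in> J\<close>] \<open>b \<noteq> Max J\<close> by simp
    moreover have "Max J < length ps" using MaxJ unfolding J(1) by blast
    ultimately show ?thesis by simp
  qed
  have good: "good (drop t ps)" using good_drop assms(1,2) by blast
  have "theta (take (Suc (b - t)) (drop t ps))"
  proof (rule theta_take[of _ "a - t"])
    show "gpath E (drop t ps)" using good by (simp add: good_def)
    show "E (drop t ps ! 0) (drop t ps ! (a - t))" "E (drop t ps ! 0) (drop t ps ! (b - t))"
      using a bc cab tc b_len by (auto simp: J'_def J(1))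
  qed (use cab tc cb b_len in auto)
  moreover have "good (take (Suc (b - t)) (drop t ps))" by (rule good_take[OF good]) simp
  moreover have "length (take (Suc (b - t)) (drop t ps)) < length ps" using b_len by simp
  ultimately show ?thesis by blast
qed

text \<open>In a shortest good theta graph, \<open>shorter_theta\<close> allows a vertex
  \<open>y\<close> of \<open>X2\<close> at most \<open>m + 2\<close> neighbours of \<open>X1\<close>
  after it and, applied to the reversed list, at most \<open>m + 2\<close> before it. As
  \<open>B \<ge> 2 * m + 5\<close>, some neighbour in \<open>X1\<close> lies outside, so the theta
  graph is well placed.\<close>

lemma no_good_theta: "good qs \<Longrightarrow> \<not> theta qs"
proof
  assume "good qs" "theta qs"
  then obtain qs where qs: "good qs" "theta qs"
    and min: "\<And>rs. \<lbrakk>good rs; theta rs\<rbrakk> \<Longrightarrow> length qs \<le> length rs"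
    using ex_has_least_nat[of "\<lambda>qs. good qs \<and> theta qs" qs length] by blast
  show False
  proof (rule no_well_placed_theta[OF i qs(2)])
    show "set qs \<subseteq> level (i - 1) \<union> level i \<union> level (Suc i)"
      using qs(1) X1 X2 X3 by (auto simp: good_def)
    fix y assume y: "y \<in> set qs \<inter> level i"
    have "y \<in> X2" using y qs(1) X1 X3 level_unique[of y i "i - 1"] level_unique[of y i "Suc i"] i
      by (fastforce simp: good_def)
    define n where "n = length qs"
    obtain t where t: "t < n" "y = qs ! t" using y by (auto simp: in_set_conv_nth n_def)
    define J where "J = {j. t < j \<and> j < n \<and> qs ! j \<in> X1 \<and> E y (qs ! j)}"
    define I where "I = {j. j < t \<and> qs ! j \<in> X1 \<and> E y (qs ! j)}"
    define I' where "I' = {j. n - Suc t < j \<and> j < n \<and> rev qs ! j \<in> X1 \<and> E (rev qs ! (n - Suc t)) (rev qs ! j)}"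
    have finJI: "finite J" "finite I" "finite I'" by (simp_all add: J_def I_def I'_def)
    have "card J < m + 3"
      using shorter_theta[OF qs(1), of t J] min t by (fastforce simp: J_def n_def)
    have "card I' < m + 3"
      using shorter_theta[OF good_rev[OF qs(1)], of "n - Suc t" I'] min t by (fastforce simp: I'_def n_def)
    have "I \<subseteq> (\<lambda>j. n - Suc j) ` I'"
    proof
      fix j assume j: "j \<in> I"
      then have "n - Suc j \<in> I'" using t by (auto simp: I_def I'_def n_def rev_nth Suc_diff_Suc)
      moreover have "j = n - Suc (n - Suc j)" using j t by (auto simp: I_def)
      ultimately show "j \<in> (\<lambda>j. n - Suc j) ` I'" by blast
    qed
    then have "card I \<le> card I'" using finJI(3) surj_card_le by blast
    have "nb y (X1 \<inter> set qs) \<subseteq> (!) qs ` (J \<union> I)"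
    proof
      fix v assume v: "v \<in> nb y (X1 \<inter> set qs)"
      then obtain j where j: "j < n" "v = qs ! j" by (auto simp: nb_def in_set_conv_nth n_def)
      have "j \<noteq> t" using v j t E_col by (auto simp: nb_def)
      then show "v \<in> (!) qs ` (J \<union> I)" using v j by (auto simp: nb_def J_def I_def)
    qed
    then have "card (nb y (X1 \<inter> set qs)) \<le> card (J \<union> I)"
      using finJI by (meson finite_UnI surj_card_le)
    also have "\<dots> \<le> card J + card I" by (rule card_Un_le)
    also have "\<dots> < B" using \<open>card J < m + 3\<close> \<open>card I' < m + 3\<close> \<open>card I \<le> card I'\<close> B by linarith
    also have "\<dots> \<le> card (nb y X1)" using deg21 \<open>y \<in> X2\<close> by blast
    finally have "\<not> nb y X1 \<subseteq> nb y (X1 \<inter> set qs)"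
      using card_mono[of "nb y (X1 \<inter> set qs)" "nb y X1"] fin finite_nb by fastforce
    then show "\<exists>z\<in>level (i - 1) - set qs. E y z" using X1 by (auto simp: nb_def)
  qed
qed

lemma good_head_neighbours:
  assumes "good ps"
  shows "card (nb (hd ps) (set ps)) \<le> 2 * k"
proof (rule ccontr)
  assume "\<not> ?thesis"
  then obtain b where b: "theta (take b ps)" using theta_head[of ps] assms by (auto simp: good_def)
  then have "0 < b" by (cases b) (auto simp: theta_def gpath_def)
  then show False using good_take[OF assms] no_good_theta b by blast
qed

text \<open>From a vertex of X2 outside bad t one can take t further steps through X3 and X2 without ever
  having to use a vertex of X3 adjacent to S0.\<close>

context
  fixes S0 :: "'a set"
  assumes S0: "S0 \<subseteq> X2"
begin

primrec bad :: "nat \<Rightarrow> 'a set" where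
  "bad 0 = S0"
| "bad (Suc t) = bad t \<union> {u \<in> X2. C \<le> 2 * card (nb u {w \<in> X3. nb w (bad t) \<noteq> {}})}"

lemma bad_subset: "bad t \<subseteq> X2"
  by (induction t) (use S0 in auto)

lemma S0_subset_bad: "S0 \<subseteq> bad t"
  by (induction t) auto

text \<open>The bad vertices spoil at most \<open>S * C\<close> vertices of \<open>X3\<close> each.
  Every new bad vertex sends at least \<open>C / 2\<close> edges to spoiled vertices, each of which
  receives at most \<open>R\<close>, so each old bad vertex creates at most \<open>2 * R * S\<close>
  new ones.\<close>

lemma card_bad: "card (bad t) \<le> card S0 * (1 + 2 * R * S) ^ t"
proof (induction t)
  case (Suc t)
  define W N where "W = {w \<in> X3. nb w (bad t) \<noteq> {}}" and "N = {u \<in> X2. C \<le> 2 * card (nb u W)}"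
  have finW: "finite W" "finite N" "finite (bad t)"
    using fin finite_subset[OF bad_subset] by (auto simp: W_def N_def)
  have "W \<subseteq> (\<Union>b\<in>bad t. nb b X3)" using E_sym by (fastforce simp: W_def nb_def)
  then have "card W \<le> card (\<Union>b\<in>bad t. nb b X3)"
    using finW fin by (intro card_mono) (auto simp: finite_nb)
  also have "\<dots> \<le> ec (bad t) X3" unfolding ec_def by (rule card_UN_le) (rule finW)
  also have "\<dots> \<le> S * C * card (bad t)" using bad_subset deg23_le by (intro ec_le_mult) blast
  finally have cW: "card W \<le> S * C * card (bad t)" .
  have "C * card N \<le> 2 * ec N W"
    using sum_bounded_below[of N C "\<lambda>u. 2 * card (nb u W)"]
    by (simp add: N_def ec_def sum_distrib_left mult.commute)
  also have "ec N W = ec W N" using finW by (intro ec_commute)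
  also have "ec W N \<le> R * card W"
  proof (rule ec_le_mult)
    fix w assume "w \<in> W"
    then have "card (nb w X2) \<le> R" using deg32_le by (simp add: W_def)
    then show "card (nb w N) \<le> R" using card_nb_mono[of X2 N w] fin by (auto simp: N_def)
  qed
  finally have "C * card N \<le> 2 * (R * (S * C * card (bad t)))"
    using cW by (meson mult_le_mono order_trans order_refl)
  also have "\<dots> = C * (2 * R * S * card (bad t))" by (simp only: mult_ac)
  finally have cN: "card N \<le> 2 * R * S * card (bad t)" using C by simp
  have "card (bad (Suc t)) \<le> card (bad t) + card N"
    unfolding bad.simps W_def[symmetric] N_def[symmetric] by (rule card_Un_le)
  also have "\<dots> \<le> (1 + 2 * R * S) * card (bad t)" using cN by (simp add: algebra_simps)
  also have "\<dots> \<le> (1 + 2 * R * S) * (card S0 * (1 + 2 * R * S) ^ t)" using Suc by (intro mult_left_mono) auto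
  finally show ?case by (simp only: power_Suc mult_ac)
qed simp

end

text \<open>The set \<open>S0\<close> of vertices of \<open>X2\<close> near the old head is kept out
  of reach: the new head avoids \<open>bad\<close> for exactly the number of steps still to be made.
  The bound on \<open>set ws \<inter> X2\<close> counts how many neighbours of the next vertex of
  \<open>X3\<close> the new segment can block.\<close>

lemma window:
  assumes ps: "good ps" "hd ps \<in> X1" and S0: "S0 = set (take (2 * k) ps) \<inter> X2" and "j < D"
  shows "\<exists>ws. length ws = 2 * j + 1 \<and> good (ws @ ps) \<and> set ws \<inter> X1 = {} \<and> hd ws \<in> X2
    \<and> hd ws \<notin> bad S0 (D - Suc j) \<and> card (set ws \<inter> X2) \<le> Suc j"
  using assms(4)
proof (induction j)
  case 0
  define v where "v = hd ps"
  have S0_X2: "S0 \<subseteq> X2" using S0 by auto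
  have "card S0 \<le> card (set (take (2 * k) ps))" unfolding S0 by (intro card_mono) auto
  also have "\<dots> \<le> 2 * k" using card_length[of "take (2 * k) ps"] by simp
  finally have cS0: "card S0 \<le> 2 * k" .
  have "card (bad S0 (D - Suc 0)) \<le> card S0 * (1 + 2 * R * S) ^ (D - Suc 0)" by (rule card_bad[OF S0_X2])
  also have "\<dots> \<le> 2 * k * (1 + 2 * R * S) ^ D"
    using cS0 by (intro mult_le_mono power_increasing) auto
  finally have "card (bad S0 (D - Suc 0) \<union> nb v (set ps)) < A"
    using A good_head_neighbours[OF ps(1)] card_Un_le[of "bad S0 (D - Suc 0)" "nb v (set ps)"]
    unfolding v_def by linarith
  also have "A \<le> card (nb v X2)" using deg12 ps v_def by blast
  finally have "\<not> nb v X2 \<subseteq> bad S0 (D - Suc 0) \<union> nb v (set ps)"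
    using card_mono[of "bad S0 (D - Suc 0) \<union> nb v (set ps)" "nb v X2"] finite_subset[OF bad_subset[OF S0_X2]] fin
    by (fastforce simp: finite_nb)
  then obtain u where u: "u \<in> X2" "E v u" "u \<notin> bad S0 (D - Suc 0)" "u \<notin> set ps"
    by (auto simp: nb_def)
  have "good (u # ps)" using good_Cons[OF ps(1)] u E_sym by (simp add: v_def)
  then show ?case using u disj by (intro exI[of _ "[u]"]) auto
next
  case (Suc j)
  have S0_X2: "S0 \<subseteq> X2" using S0 by auto
  obtain ws where ws: "length ws = 2 * j + 1" "good (ws @ ps)" "set ws \<inter> X1 = {}" "hd ws \<in> X2"
      "hd ws \<notin> bad S0 (D - Suc j)" "card (set ws \<inter> X2) \<le> Suc j"
    using Suc by auto
  define u t where "u = hd ws" and "t = D - Suc (Suc j)"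
  have t: "D - Suc j = Suc t" using Suc.prems by (simp add: t_def)
  have ws_ne: "ws \<noteq> []" using ws(1) by auto
  define W where "W = {w \<in> X3. nb w (bad S0 t) \<noteq> {}}"
  have "2 * card (nb u W) < C" using ws(4,5) S0_X2 unfolding u_def t W_def by simp
  moreover have "card (nb u (set (ws @ ps))) \<le> 2 * k"
    using good_head_neighbours[OF ws(2)] ws_ne by (simp add: u_def)
  ultimately have "card (nb u W \<union> nb u (set (ws @ ps))) < C"
    using C card_Un_le[of "nb u W" "nb u (set (ws @ ps))"] by linarith
  also have "C \<le> card (nb u X3)" using deg23 ws(4) by (simp add: u_def)
  finally have "\<not> nb u X3 \<subseteq> nb u W \<union> nb u (set (ws @ ps))"
    using card_mono[of "nb u W \<union> nb u (set (ws @ ps))" "nb u X3"] fin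
    by (fastforce simp: finite_nb W_def)
  then obtain w where w: "w \<in> X3" "E u w" "w \<notin> W" "w \<notin> set (ws @ ps)"
    by (auto simp: nb_def)
  have good_w: "good (w # ws @ ps)"
    using good_Cons[OF ws(2)] w E_sym ws_ne by (simp add: u_def)
  have w_bad: "\<not> E w v" if "v \<in> bad S0 t" for v
    using w(1,3) that by (auto simp: W_def nb_def)
  have "\<exists>u'\<in>nb w X2. u' \<notin> set (ws @ ps)"
  proof (rule ccontr)
    assume no: "\<not> ?thesis"
    \<comment> \<open>\<open>F\<close> consists of the neighbours of \<open>w\<close> on the old
      path. They lie outside \<open>S0\<close>, hence more than 2k positions away from
      \<open>w\<close>, and two of them would already give a good theta graph. So \<open>F\<close>
      and \<open>ws\<close> together block at most \<open>D\<close> of the \<open>Suc D\<close>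
      neighbours of \<open>w\<close>.\<close>
    define F where "F = nb w X2 - set ws"
    have F_idx: "\<exists>a. 2 * k < a \<and> a < length (w # ws @ ps) \<and> (w # ws @ ps) ! a = f" if f: "f \<in> F" for f
    proof -
      have "f \<in> set ps" using no f by (auto simp: F_def)
      then obtain a where a: "a < length ps" "ps ! a = f" by (auto simp: in_set_conv_nth)
      have "2 * k \<le> a"
      proof (rule ccontr)
        assume "\<not> 2 * k \<le> a"
        then have "f \<in> set (take (2 * k) ps)" using a by (auto simp: in_set_conv_nth intro!: exI[of _ a])
        then have "f \<in> bad S0 t" using S0_subset_bad[OF S0_X2] f by (auto simp: S0 F_def nb_def)
        then show False using w_bad f by (auto simp: F_def nb_def)
      qed
      then show ?thesis using a by (intro exI[of _ "Suc (length ws + a)"]) (auto simp: nth_append)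
    qed
    have F_unique: "f = g" if fg: "f \<in> F" "g \<in> F" for f g
    proof (rule ccontr)
      assume "f \<noteq> g"
      define qs where "qs = w # ws @ ps"
      obtain a b where ab: "2 * k < a" "a < length qs" "qs ! a = f" "2 * k < b" "b < length qs" "qs ! b = g"
        using F_idx[OF fg(1)] F_idx[OF fg(2)] unfolding qs_def[symmetric] by blast
      have "a \<noteq> b" using ab \<open>f \<noteq> g\<close> by auto
      have E0: "E (qs ! 0) f" "E (qs ! 0) g" using fg by (simp_all add: qs_def F_def nb_def)
      have "\<exists>a b. 2 * k < a \<and> a < b \<and> b < length qs \<and> E (qs ! 0) (qs ! a) \<and> E (qs ! 0) (qs ! b)"
        using ab E0 \<open>a \<noteq> b\<close> by (metis linorder_neqE_nat)
      then obtain a b where ab: "2 * k < a" "a < b" "b < length qs" "E (qs ! 0) (qs ! a)" "E (qs ! 0) (qs ! b)"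
        by blast
      have "theta (take (Suc b) qs)"
        by (rule theta_take[of _ a]) (use ab good_w k in \<open>auto simp: good_def qs_def\<close>)
      moreover have "good (take (Suc b) qs)" using good_w unfolding qs_def by (rule good_take) simp
      ultimately show False using no_good_theta by blast
    qed
    have "card F \<le> 1"
      using F_unique by (metis One_nat_def card.infinite card_le_Suc0_iff_eq le_SucI order_refl)
    have "nb w X2 \<subseteq> (set ws \<inter> X2) \<union> F" by (auto simp: F_def nb_def)
    then have "card (nb w X2) \<le> card ((set ws \<inter> X2) \<union> F)"
      using fin by (intro card_mono) (auto simp: F_def finite_nb)
    also have "\<dots> \<le> card (set ws \<inter> X2) + card F" by (rule card_Un_le)
    also have "\<dots> \<le> D" using ws(6) \<open>card F \<le> 1\<close> Suc.prems by linarith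
    finally show False using deg32[OF w(1)] by simp
  qed
  then obtain u' where u': "u' \<in> X2" "E w u'" "u' \<notin> set (ws @ ps)" by (auto simp: nb_def)
  have ne: "u' \<noteq> w" using u' w disj by auto
  have "good (u' # w # ws @ ps)" using good_Cons[OF good_w] u' ne E_sym by simp
  moreover have "u' \<notin> bad S0 t" using w_bad u' by blast
  moreover have "card (set (u' # w # ws) \<inter> X2) \<le> Suc (Suc j)"
  proof -
    have "set (u' # w # ws) \<inter> X2 \<subseteq> insert u' (set ws \<inter> X2)" using w(1) disj by auto
    then have "card (set (u' # w # ws) \<inter> X2) \<le> card (insert u' (set ws \<inter> X2))"
      by (intro card_mono) auto
    also have "\<dots> \<le> Suc (card (set ws \<inter> X2))" by (simp add: card_insert_if)
    finally show ?thesis using ws(6) by simp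
  qed
  moreover have "set (u' # w # ws) \<inter> X1 = {}" using u' w ws(3) disj by auto
  ultimately show ?case
    using ws(1) u'(1) unfolding t_def by (intro exI[of _ "u' # w # ws"]) auto
qed

text \<open>A full window has \<open>2 * D - 1\<close> vertices, so a new head in \<open>X1\<close>
  is exactly \<open>2 * D\<close> positions from the old one. It exists because the front of the
  window has fewer than \<open>B\<close> neighbours of \<open>X1\<close> on the path.\<close>

lemma good_extend:
  assumes ps: "good ps" "hd ps \<in> X1"
  shows "\<exists>qs. good qs \<and> hd qs \<in> X1 \<and> length ps < length qs"
proof -
  obtain ws where ws: "length ws = 2 * (D - 1) + 1" "good (ws @ ps)" "set ws \<inter> X1 = {}" "hd ws \<in> X2"
    using window[OF ps refl, of "D - 1"] D by auto
  have len: "length ws = 2 * D - 1" using ws(1) D by simp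
  define n where "n = length (ws @ ps)"
  define u where "u = hd ws"
  have u: "u = (ws @ ps) ! 0" using len D by (cases ws) (auto simp: u_def)
  define J where "J = {j. 0 < j \<and> j < n \<and> (ws @ ps) ! j \<in> X1 \<and> E ((ws @ ps) ! 0) ((ws @ ps) ! j)}"
  have "card J < m + 3"
    using shorter_theta[OF ws(2), of 0 J] no_good_theta len D by (fastforce simp: J_def n_def)
  have "nb u (X1 \<inter> set (ws @ ps)) \<subseteq> (!) (ws @ ps) ` J"
  proof
    fix v assume v: "v \<in> nb u (X1 \<inter> set (ws @ ps))"
    then have "v \<in> set (ws @ ps)" by (simp add: nb_def)
    then obtain j where j: "j < n" "v = (ws @ ps) ! j" by (metis in_set_conv_nth n_def)
    have "j \<noteq> 0"
    proof
      assume "j = 0"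
      then show False using v j u E_col[of u u] by (simp add: nb_def)
    qed
    then show "v \<in> (!) (ws @ ps) ` J" using v j u by (auto simp: nb_def J_def)
  qed
  then have "card (nb u (X1 \<inter> set (ws @ ps))) \<le> card J"
    by (intro surj_card_le) (auto simp: J_def)
  also have "\<dots> < B" using \<open>card J < m + 3\<close> B by linarith
  also have "B \<le> card (nb u X1)" using deg21 ws(4) by (simp add: u_def)
  finally have "\<not> nb u X1 \<subseteq> nb u (X1 \<inter> set (ws @ ps))"
    using card_mono[of "nb u (X1 \<inter> set (ws @ ps))" "nb u X1"] fin by (fastforce simp: finite_nb)
  then obtain v where v: "v \<in> X1" "E u v" "v \<notin> set (ws @ ps)" by (auto simp: nb_def)
  have "good (v # ws @ ps)"
    unfolding good_def
  proof (intro conjI allI impI)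
    show "gpath E (v # ws @ ps)"
      using ws(2) v E_sym len D by (cases ws) (auto simp: good_def gpath_def u_def)
    show "set (v # ws @ ps) \<subseteq> X1 \<union> X2 \<union> X3" using ws(2) v by (auto simp: good_def)
    fix a b assume ab: "a < b \<and> b < length (v # ws @ ps) \<and> (v # ws @ ps) ! a \<in> X1 \<and> (v # ws @ ps) ! b \<in> X1"
    then obtain b' where b': "b = Suc b'" by (cases b) auto
    show "a + 2 * D \<le> b"
    proof (cases a)
      case 0
      have "\<not> b' < length ws"
      proof
        assume "b' < length ws"
        then have "(ws @ ps) ! b' \<in> set ws" by (simp add: nth_append)
        then show False using ab b' ws(3) by auto
      qed
      then show ?thesis using 0 b' len by simp
    next
      case (Suc a')
      then show ?thesis using good_spacing[OF ws(2), of a' b'] ab b' by simp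
    qed
  qed
  then show ?thesis using v by (intro exI[of _ "v # ws @ ps"]) auto
qed

text \<open>A good path starting in \<open>X1\<close> could be extended forever in a finite graph.
  Emptiness is the form in which the contradiction is exported.\<close>

lemma X1_empty: "X1 = {}"
proof (rule ccontr)
  assume "X1 \<noteq> {}"
  then obtain v where "v \<in> X1" by blast
  then have start: "good [v] \<and> hd [v] \<in> X1" by (simp add: good_def gpath_def)
  have "length qs < Suc (card (X1 \<union> X2 \<union> X3))" if "good qs" for qs
  proof -
    have "length qs = card (set qs)" using that by (simp add: good_def gpath_def distinct_card)
    also have "\<dots> \<le> card (X1 \<union> X2 \<union> X3)" using that fin by (intro card_mono) (auto simp: good_def)
    finally show ?thesis by simp
  qed
  then obtain ps where "good ps" "hd ps \<in> X1"
      "\<And>qs. \<lbrakk>good qs; hd qs \<in> X1\<rbrakk> \<Longrightarrow> length qs \<le> length ps"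
    using ex_has_greatest_nat[of "\<lambda>qs. good qs \<and> hd qs \<in> X1" "[v]" length, OF start] by blast
  then show False using good_extend by (meson not_le)
qed

end

section \<open>Regularisation of three consecutive levels\<close>

text \<open>A triple of minimal size on which the potential is positive has all the minimum degrees: deleting
  a vertex of too small degree does not decrease the potential. The penalty for the edges from X2 to
  the deleted part of V1 pays for the edges to X3 of a vertex that lost half of its neighbours in V1.\<close>

lemma (in bip_graph) prune_layers:
  fixes A B C D M :: real
  assumes fin: "finite V1" "finite V2" "finite V3"
    and pos: "0 \<le> A" "0 < B" "0 \<le> C" "0 \<le> D" "0 \<le> M"
    and deg1: "\<And>u. u \<in> V2 \<Longrightarrow> 2 * B \<le> card (nb u V1)"
    and deg3: "\<And>u. u \<in> V2 \<Longrightarrow> card (nb u V3) \<le> M"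
    and many: "D * card V3 + C * card V2 + M / B * A * card V1 < ec V2 V3"
  obtains X1 X2 X3 where "X1 \<subseteq> V1" "X2 \<subseteq> V2" "X3 \<subseteq> V3" "X2 \<noteq> {}"
    "\<And>u. u \<in> X1 \<Longrightarrow> A \<le> card (nb u X2)" "\<And>u. u \<in> X2 \<Longrightarrow> B \<le> card (nb u X1)"
    "\<And>u. u \<in> X2 \<Longrightarrow> C \<le> card (nb u X3)" "\<And>u. u \<in> X3 \<Longrightarrow> D \<le> card (nb u X2)"
proof -
  define l where "l = M / B"
  have l: "0 \<le> l" "l * B = M" using pos by (simp_all add: l_def)
  define Psi where "Psi X1 X2 X3 = real (ec X2 X3) - D * card X3 - C * card X2
    - l * ec X2 (V1 - X1) - l * A * card X1" for X1 X2 X3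
  define valid where "valid t \<longleftrightarrow> (case t of (X1, X2, X3) \<Rightarrow>
    X1 \<subseteq> V1 \<and> X2 \<subseteq> V2 \<and> X3 \<subseteq> V3 \<and> 0 < Psi X1 X2 X3)" for t
  define size where "size t = (case t of (X1, X2, X3) \<Rightarrow> card X1 + card X2 + card X3)"
    for t :: "'a set \<times> 'a set \<times> 'a set"
  have "valid (V1, V2, V3)" 
  proof -
    have "ec V2 (V1 - V1) = 0" by (simp add: ec_def nb_def)
    then show ?thesis using many by (simp add: valid_def Psi_def l_def)
  qed
  then obtain t where t: "valid t" "\<And>s. valid s \<Longrightarrow> size t \<le> size s"
    using ex_has_least_nat[of valid "(V1, V2, V3)" size] by blast
  obtain X1 X2 X3 where X: "t = (X1, X2, X3)" by (cases t)
  have sub: "X1 \<subseteq> V1" "X2 \<subseteq> V2" "X3 \<subseteq> V3" and Psi: "0 < Psi X1 X2 X3"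
    using t(1) by (auto simp: X valid_def)
  have finX: "finite X1" "finite X2" "finite X3" using sub fin finite_subset by blast+
  have min: "\<not> (0 < Psi Y1 Y2 Y3)"
    if "Y1 \<subseteq> X1" "Y2 \<subseteq> X2" "Y3 \<subseteq> X3" "card Y1 + card Y2 + card Y3 < card X1 + card X2 + card X3"
    for Y1 Y2 Y3
  proof -
    have "Y1 \<subseteq> V1 \<and> Y2 \<subseteq> V2 \<and> Y3 \<subseteq> V3" using that sub by blast
    then show ?thesis using t(2)[of "(Y1, Y2, Y3)"] that(4) by (auto simp: X valid_def size_def)
  qed
  have cR: "real (card Z) = 1 + real (card (Z - {u}))" if "finite Z" "u \<in> Z" for Z :: "'a set" and u
    using card_Suc_Diff1[OF that] by linarith
  have cN: "card (Z - {u}) < card Z" if "finite Z" "u \<in> Z" for Z :: "'a set" and u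
    using card_Diff1_less[OF that] .
  show ?thesis
  proof (rule that[OF sub])
    show "X2 \<noteq> {}"
    proof
      assume "X2 = {}"
      then have "0 < - (D * card X3 + l * A * card X1)" using Psi by (simp add: Psi_def ec_def)
      moreover have "0 \<le> D * card X3 + l * A * card X1" using pos l by simp
      ultimately show False by linarith
    qed
    fix u
    show "A \<le> card (nb u X2)" if u: "u \<in> X1"
    proof (rule ccontr)
      assume less: "\<not> ?thesis"
      have "V1 - (X1 - {u}) = (V1 - X1) \<union> {u}" using u sub by auto
      then have "ec X2 (V1 - (X1 - {u})) = ec X2 (V1 - X1) + ec X2 {u}"
        using ec_Un_right[of "V1 - X1" "{u}" X2] fin u by auto
      also have "ec X2 {u} = card (nb u X2)" using ec_commute[OF finX(2), of "{u}"] by (simp add: ec_def)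
      finally have "Psi (X1 - {u}) X2 X3 = Psi X1 X2 X3 + l * (A - card (nb u X2))"
        using cR[OF finX(1) u] by (simp add: Psi_def algebra_simps)
      then have "0 < Psi (X1 - {u}) X2 X3" using Psi less l by (simp add: add_pos_nonneg)
      then show False using min[of "X1 - {u}" X2 X3] cN[OF finX(1) u] by auto
    qed
    show "D \<le> card (nb u X2)" if u: "u \<in> X3"
    proof (rule ccontr)
      assume less: "\<not> ?thesis"
      have "ec X2 X3 = card (nb u X2) + ec X2 (X3 - {u})"
        using ec_remove[OF finX(3) u, of X2] ec_commute[OF finX(2), of X3] ec_commute[OF finX(2), of "X3 - {u}"] finX
        by simp
      then have "Psi X1 X2 (X3 - {u}) = Psi X1 X2 X3 + (D - card (nb u X2))"
        using cR[OF finX(3) u] by (simp add: Psi_def algebra_simps)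
      then have "0 < Psi X1 X2 (X3 - {u})" using Psi less by simp
      then show False using min[of X1 X2 "X3 - {u}"] cN[OF finX(3) u] by auto
    qed
    have remove2: "0 \<le> C - card (nb u X3) + l * card (nb u (V1 - X1)) \<Longrightarrow> False" if u: "u \<in> X2"
    proof -
      assume p: "0 \<le> C - card (nb u X3) + l * card (nb u (V1 - X1))"
      have "Psi X1 (X2 - {u}) X3 = Psi X1 X2 X3 + (C - card (nb u X3) + l * card (nb u (V1 - X1)))"
        using cR[OF finX(2) u] ec_remove[OF finX(2) u, of X3] ec_remove[OF finX(2) u, of "V1 - X1"]
        by (simp add: Psi_def algebra_simps)
      then have "0 < Psi X1 (X2 - {u}) X3" using Psi p by simp
      then show False using min[of X1 "X2 - {u}" X3] cN[OF finX(2) u] by auto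
    qed
    show "C \<le> card (nb u X3)" if u: "u \<in> X2"
    proof (rule ccontr)
      assume less: "\<not> ?thesis"
      have "0 \<le> l * card (nb u (V1 - X1))" using l(1) by simp
      then show False using remove2[OF u] less by linarith
    qed
    show "B \<le> card (nb u X1)" if u: "u \<in> X2"
    proof (rule ccontr)
      assume less: "\<not> ?thesis"
      have "V1 = X1 \<union> (V1 - X1)" using sub by auto
      then have "card (nb u V1) = card (nb u X1) + card (nb u (V1 - X1))"
        using card_nb_Un[of X1 "V1 - X1" u] fin finX by auto
      then have "B \<le> card (nb u (V1 - X1))" using deg1[of u] u sub less by auto
      then have "M \<le> l * card (nb u (V1 - X1))" using l mult_left_mono[of B _ l] by metis
      moreover have "card (nb u X3) \<le> card (nb u V3)" using card_nb_mono fin sub by blast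
      moreover have "card (nb u V3) \<le> M" using deg3 u sub by blast
      ultimately show False using remove2[OF u] pos by linarith
    qed
  qed
qed

section \<open>Dyadic classes of vertices\<close>

lemma ex_dyadic:
  fixes y :: real
  assumes "1 \<le> y"
  obtains j :: nat where "2 ^ j \<le> y" "y < 2 ^ Suc j"
proof -
  obtain n where n: "y < 2 ^ n" using real_arch_pow[of 2 y] by auto
  define j where "j = (LEAST n. y < 2 ^ n)"
  have j: "y < 2 ^ j" unfolding j_def by (rule LeastI[of _ n]) (rule n)
  then have "j \<noteq> 0" using assms by (cases j) auto
  then obtain i where i: "j = Suc i" by (cases j) auto
  then have "\<not> y < 2 ^ i" using not_less_Least[of i "\<lambda>n. y < 2 ^ n"] by (simp add: j_def)
  then show ?thesis using that[of i] j i by auto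
qed

text \<open>Giving the values of \<open>j\<close> geometrically decreasing shares makes the loss
  independent of how many values occur; only the \<open>N\<close> values of \<open>a\<close> cost a
  uniform factor. In the application the loss \<open>2 ^ Suc j0\<close> is regained up to a factor
  2, because the vertices of this class have forward degree at least
  \<open>2 ^ j0 * d\<close>.\<close>

lemma dyadic_pigeonhole:
  fixes p :: "'b \<Rightarrow> real" and a j :: "'b \<Rightarrow> nat"
  assumes "finite Y" "Y \<noteq> {}" and a: "\<And>u. u \<in> Y \<Longrightarrow> a u < N" and p: "\<And>u. u \<in> Y \<Longrightarrow> 0 \<le> p u"
  obtains a0 j0 where "sum p Y \<le> real N * 2 ^ Suc j0 * sum p {u \<in> Y. a u = a0 \<and> j u = j0}"
proof (rule ccontr)
  assume contra: "\<not> thesis"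
  define q where "q = sum p Y"
  define J where "J = Suc (Max (j ` Y))"
  define T where "T = {..<N} \<times> {..<J}"
  have N: "0 < N" using assms by fastforce
  have less: "sum p {u \<in> Y. (a u, j u) = t} < q / N / 2 ^ Suc (snd t)" for t
    using contra that[of "snd t" "fst t"] N
    by (cases t) (fastforce simp: field_simps not_le q_def)
  have "(\<lambda>u. (a u, j u)) ` Y \<subseteq> T"
    using a assms(1) by (auto simp: T_def J_def le_imp_less_Suc)
  then have "q = (\<Sum>t\<in>T. sum p {u \<in> Y. (a u, j u) = t})"
    unfolding q_def using assms(1) by (intro sum.group[symmetric]) (auto simp: T_def)
  also have "\<dots> < (\<Sum>t\<in>T. q / N / 2 ^ Suc (snd t))"
    using less N by (intro sum_strict_mono) (auto simp: T_def J_def lessThan_empty_iff)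
  also have "\<dots> = (\<Sum>a<N. \<Sum>j<J. q / N / 2 ^ Suc j)"
    unfolding T_def by (simp only: sum.cartesian_product case_prod_unfold)
  also have "\<dots> = (\<Sum>j<J. N * (q / N / 2 ^ Suc j))"
    by (simp add: sum_distrib_left)
  also have "\<dots> = (\<Sum>j<J. q * (1 / 2 ^ Suc j))"
    using N by (intro sum.cong) simp_all
  also have "\<dots> = q * (\<Sum>j<J. 1 / 2 ^ Suc j)"
    by (rule sum_distrib_left[symmetric])
  also have "(\<Sum>j<J. 1 / 2 ^ Suc j) = 1 - (1 / 2 :: real) ^ J"
    by (induction J) (simp_all add: field_simps)
  finally have "q < q * (1 - (1 / 2) ^ J)" .
  moreover have "q * (1 - (1 / 2) ^ J) \<le> q * 1"
    unfolding q_def using p by (intro mult_left_mono sum_nonneg) auto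
  ultimately show False by simp
qed

section \<open>Growth over two consecutive steps\<close>

context dense_even_cycle_free
begin

text \<open>In \<open>ec_level_pair\<close> the term \<open>2 * k * card Y\<close> is at most half
  of the edges, so the other term is at least half. Vertices of high degree towards the root can
  therefore be discarded cheaply, which is where upper degree bounds come from.\<close>

lemma ec_high_degree:
  assumes "i < k" "X \<subseteq> level i" "Y \<subseteq> level (Suc i)" and high: "\<And>w. w \<in> Y \<Longrightarrow> 4 * k \<le> card (nb w X)"
  shows "ec X Y \<le> 4 * k * card X"
proof -
  have fin: "finite X" "finite Y" using assms finite_level finite_subset by blast+
  have "4 * k * card Y \<le> ec Y X"
    using sum_bounded_below[of Y "4 * k" "\<lambda>w. card (nb w X)"] high by (simp add: ec_def mult.commute)
  also have "ec Y X = ec X Y" by (rule ec_commute[OF fin(2,1)])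
  finally have "4 * k * card Y \<le> ec X Y" .
  moreover have "ec X Y \<le> 2 * k * card X + 2 * k * card Y"
    using ec_level_pair[OF assms(1-3)] by (simp add: distrib_left)
  ultimately show ?thesis by linarith
qed

text \<open>If the growth failed, a dyadic class \<open>Y\<close> on level \<open>i\<close> would
  satisfy \<open>P * D0 \<ge> K * k / 4\<close>, with \<open>P\<close> a lower bound for its degrees
  towards level \<open>i - 1\<close> and \<open>D0\<close> a quarter of the average number of
  neighbours in \<open>Y\<close> of a vertex of level \<open>i + 1\<close>. Pruning then gives a
  \<open>trilayer\<close> with nonempty \<open>X1\<close>. The factor \<open>N\<close> is the number
  of dyadic classes for the degrees towards level \<open>i - 1\<close>.\<close>

lemma two_level_growth:
  fixes T K :: real and N A :: nat
  assumes i: "1 \<le> i" "i < k"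
    and large: "64 * k \<le> dl - 8 * k" and N: "4 * k \<le> 2 ^ N"
    and T: "\<And>u. u \<in> V \<Longrightarrow> card (nb u V) \<le> (dl - 8 * k) * T"
    and A: "2 * k * (1 + 128 * k) ^ k + 2 * k < A" "64 * real A * real N * T \<le> dl - 8 * k"
    and K: "96 \<le> K"
  shows "(dl - 8 * k)\<^sup>2 * card (level (i - 1)) < 4 * K * k * N * card (level (Suc i))"
proof (rule ccontr)
  assume contra: "\<not> ?thesis"
  define d where "d = dl - 8 * k"
  define n1 n3 where "n1 = real (card (level (i - 1)))" and "n3 = real (card (level (Suc i)))"
  have small: "4 * K * k * N * n3 \<le> d\<^sup>2 * n1" using contra by (simp add: d_def n1_def n3_def)
  have k_pos: "0 < real k" using k by simp
  have d: "64 * k \<le> d" "0 < d" using large k_pos unfolding d_def by linarith+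
  have fin: "finite (level j)" for j by (rule finite_level)
  have i1: "i - 1 < k" "Suc (i - 1) = i" using i by auto
  have "1 \<le> card (level j)" if "j \<le> k" for j
    using that
  proof (induction j)
    case (Suc j)
    then show ?case using level_growth[of j] by auto
  qed (simp add: level_0)
  then have "1 \<le> card (level (i - 1))" using i by simp
  then have "card (level (i - 1)) \<noteq> 0" by linarith
  then have n1: "0 < n1" by (simp add: n1_def)
  \<comment> \<open>Discarding \<open>H\<close> loses at most 4k edges per vertex of level
    \<open>i - 1\<close>; with the 4k lost in \<open>level_growth\<close> this explains
    \<open>d = dl - 8 * k\<close>. In \<open>G\<close> the degrees towards the root are below 4k, so
    \<open>N\<close> classes suffice.\<close>
  define H where "H = {u \<in> level i. 4 * k \<le> card (nb u (level (i - 1)))}"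
  define G where "G = level i - H"
  have finG: "finite G" "finite H" using fin by (simp_all add: G_def H_def)
  define p where "p u = real (card (nb u (level (i - 1))))" for u
  define r where "r u = real (card (nb u (level (Suc i))))" for u
  have "d * n1 \<le> sum p G"
  proof -
    have "(dl - real (4 * k)) * n1 \<le> ec (level (i - 1)) (level i)"
      using level_growth[OF i1(1)] i1(2) by (simp add: n1_def)
    moreover have "ec (level (i - 1)) H \<le> 4 * k * card (level (i - 1))"
      by (rule ec_high_degree[OF i1(1) order_refl, unfolded i1(2)]) (auto simp: H_def)
    then have "real (ec (level (i - 1)) H) \<le> 4 * k * n1"
      unfolding n1_def of_nat_mult[symmetric] by (rule of_nat_mono)
    moreover have "ec (level (i - 1)) (level i) = ec (level (i - 1)) H + ec (level (i - 1)) G"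
      unfolding G_def by (rule ec_split_right) (auto simp: H_def fin)
    moreover have "ec (level (i - 1)) G = ec G (level (i - 1))" by (rule ec_commute[OF fin finG(1)])
    moreover have "ec G (level (i - 1)) = sum p G" by (simp add: ec_def p_def)
    ultimately show ?thesis by (simp add: d_def algebra_simps)
  qed
  have G_level: "u \<in> level i" if "u \<in> G" for u using that by (simp add: G_def)
  have p: "1 \<le> p u" "p u < 4 * k" if uG: "u \<in> G" for u
  proof -
    obtain v where "v \<in> nb u (level (i - 1))"
      using level_parent[of u "i - 1"] G_level[OF uG] i1(2) by (fastforce simp: nb_def)
    then have "card (nb u (level (i - 1))) \<noteq> 0" using finite_nb[OF fin] by auto
    then show "1 \<le> p u" by (simp add: p_def)
    show "p u < 4 * k" using that by (auto simp: G_def H_def p_def not_le)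
  qed
  have r: "d \<le> r u" "r u \<le> d * T" if "u \<in> G" for u
  proof -
    have uV: "u \<in> V" using G_level[OF that] level_subset_V by blast
    have "card (nb u V) = p u + r u"
      using nb_level_Suc[of u "i - 1"] G_level[OF that] i1 by (simp add: p_def r_def)
    then show "d \<le> r u" "r u \<le> d * T"
      using min_degree[OF uV] T[OF uV] p[OF that] k_pos unfolding d_def by linarith+
  qed
  have "\<exists>a. 2 ^ a \<le> p u \<and> p u < 2 ^ Suc a" if "u \<in> G" for u
    using ex_dyadic[OF p(1)[OF that]] by metis
  then obtain a where a: "\<And>u. u \<in> G \<Longrightarrow> 2 ^ a u \<le> p u" "\<And>u. u \<in> G \<Longrightarrow> p u < 2 ^ Suc (a u)"
    by metis
  have "\<exists>j. 2 ^ j \<le> r u / d \<and> r u / d < 2 ^ Suc j" if "u \<in> G" for u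
    using ex_dyadic[of "r u / d"] r(1)[OF that] d by (simp add: le_divide_eq) metis
  then obtain j where j: "\<And>u. u \<in> G \<Longrightarrow> 2 ^ j u \<le> r u / d" "\<And>u. u \<in> G \<Longrightarrow> r u / d < 2 ^ Suc (j u)"
    by metis
  have aN: "a u < N" if "u \<in> G" for u
  proof -
    have "(2::real) ^ a u < 4 * k" using a(1)[OF that] p(2)[OF that] by simp
    also have "\<dots> \<le> 2 ^ N" using of_nat_mono[OF N, where 'a = real] by simp
    finally show ?thesis by simp
  qed
  have "G \<noteq> {}" using \<open>d * n1 \<le> sum p G\<close> mult_pos_pos[OF d(2) n1] by auto
  obtain a0 j0 where pigeon: "sum p G \<le> real N * 2 ^ Suc j0 * sum p {u \<in> G. a u = a0 \<and> j u = j0}"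
  proof (rule dyadic_pigeonhole[of G a N p j])
    fix u assume "u \<in> G"
    then show "a u < N" by (rule aN)
  qed (use finG(1) \<open>G \<noteq> {}\<close> in \<open>auto simp: p_def\<close>)
  define Y where "Y = {u \<in> G. a u = a0 \<and> j u = j0}"
  define c P where "c = 2 ^ j0 * d" and "P = (2::real) ^ a0"
  have finY: "finite Y" using finG by (simp add: Y_def)
  have Y_level: "Y \<subseteq> level i" using G_level by (auto simp: Y_def)
  have pY: "P \<le> p u" "p u \<le> 2 * P" if "u \<in> Y" for u
    using a[of u] that by (auto simp: Y_def P_def)
  have rY: "c \<le> r u" "r u \<le> 2 * c" if "u \<in> Y" for u
    using j[of u] that d by (auto simp: Y_def c_def field_simps)
  have pos: "0 < sum p G" using \<open>d * n1 \<le> sum p G\<close> mult_pos_pos[OF d(2) n1] by linarith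
  have "Y \<noteq> {}"
  proof
    assume "Y = {}"
    then show False using pigeon pos by (simp add: Y_def[symmetric])
  qed
  then obtain y where y: "y \<in> Y" by blast
  have N_pos: "0 < real N" using aN[of y] y by (simp add: Y_def)
  have P: "1 \<le> P" "P < 4 * k" using pY(1)[OF y] p(2)[of y] y by (auto simp: P_def Y_def)
  have j0T: "2 ^ j0 \<le> T"
  proof -
    have "2 ^ j0 * d \<le> d * T" using rY(1)[OF y] r(2)[of y] y by (auto simp: c_def Y_def)
    then show ?thesis using d by (simp add: mult.commute)
  qed
  have c: "d \<le> c" using d by (simp add: c_def)
  define s where "s = sum p Y"
  have s_le: "s \<le> 2 * P * card Y"
    using sum_bounded_above[of Y p "2 * P"] pY by (simp add: s_def mult.commute)
  have s_ge: "d * n1 \<le> real N * 2 ^ Suc j0 * s"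
    using \<open>d * n1 \<le> sum p G\<close> pigeon by (simp add: s_def Y_def)
  define e where "e = real (ec Y (level (Suc i)))"
  have e_sum: "e = sum r Y" by (simp add: e_def ec_def r_def)
  have e_ge: "c * card Y \<le> e"
    unfolding e_sum using sum_bounded_below[of Y c r] rY by (simp add: mult.commute)
  have cs: "c * s \<le> 2 * P * e"
  proof -
    have "c * s \<le> c * (2 * P * card Y)" using s_le c d by (intro mult_left_mono) auto
    also have "\<dots> = 2 * P * (c * card Y)" by simp
    also have "\<dots> \<le> 2 * P * e" using e_ge P by (intro mult_left_mono) auto
    finally show ?thesis .
  qed
  have e_n1: "d * (d * n1) \<le> 4 * N * (P * e)"
  proof -
    have "d * (d * n1) \<le> d * (real N * 2 ^ Suc j0 * s)" using s_ge d by (intro mult_left_mono) auto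
    also have "\<dots> = 2 * N * (c * s)" by (simp add: c_def)
    also have "\<dots> \<le> 2 * N * (2 * P * e)" using cs by (intro mult_left_mono) auto
    finally show ?thesis by simp
  qed
  have e_n3: "K * k * n3 \<le> P * e"
  proof -
    have "4 * N * (K * k * n3) \<le> 4 * N * (P * e)"
      using small e_n1 by (simp add: power2_eq_square mult_ac)
    then show ?thesis using N_pos by simp
  qed
  have cY: "0 < real (card Y)" using y finY by (simp add: card_gt_0_iff) blast
  have e_pos: "0 < e" using e_ge mult_pos_pos[of c "real (card Y)"] cY c d by linarith
  have dY: "d * card Y \<le> e"
    using e_ge mult_right_mono[OF c, of "real (card Y)"] by linarith
  then have kY: "64 * k * card Y \<le> e"
    using mult_right_mono[OF d(1), of "real (card Y)"] by simp
  have e_le: "e \<le> 4 * k * n3"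
  proof -
    have "ec Y (level (Suc i)) \<le> 2 * k * (card Y + card (level (Suc i)))"
      by (rule ec_level_pair[OF i(2) Y_level order_refl])
    then have "e \<le> real (2 * k * (card Y + card (level (Suc i))))" unfolding e_def by (rule of_nat_mono)
    also have "\<dots> = 2 * k * card Y + 2 * k * n3" by (simp add: n3_def algebra_simps)
    finally show ?thesis using kY by linarith
  qed
  have n3: "0 < n3"
  proof (rule ccontr)
    assume "\<not> ?thesis"
    then have "n3 = 0" by (simp add: n3_def)
    then show False using e_le e_pos by simp
  qed
  define D0 where "D0 = e / (4 * n3)"
  have D0: "D0 \<le> k" "K * k \<le> 4 * (P * D0)"
    using e_le e_n3 n3 by (simp_all add: D0_def field_simps)
  have D0_ge: "K \<le> 16 * D0"
  proof -
    have "0 \<le> D0" using e_pos n3 by (simp add: D0_def)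
    then have "P * D0 \<le> 4 * k * D0" using P by (intro mult_right_mono) auto
    moreover have "4 * (4 * k * D0) = 16 * D0 * real k" by simp
    ultimately have "K * k \<le> 16 * D0 * k" using D0(2) by linarith
    then show ?thesis using k_pos by simp
  qed
  define H3 where "H3 = {w \<in> level (Suc i). 4 * k \<le> card (nb w Y)}"
  define V3 where "V3 = level (Suc i) - H3"
  have finV3: "finite V3" using fin by (simp add: V3_def)
  have "ec Y H3 \<le> 4 * k * card Y"
    by (rule ec_high_degree[OF i(2) Y_level]) (auto simp: H3_def)
  then have "real (ec Y H3) \<le> 4 * k * real (card Y)" unfolding of_nat_mult[symmetric] by (rule of_nat_mono)
  then have H3_le: "16 * real (ec Y H3) \<le> e" using kY unfolding of_nat_mult of_nat_numeral by linarith
  have split: "e = ec Y H3 + ec Y V3"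
    unfolding e_def V3_def of_nat_add[symmetric] of_nat_eq_iff
    by (rule ec_split_right) (auto simp: H3_def fin)
  \<comment> \<open>Removing \<open>H3\<close> keeps at least 15/16 of the \<open>e\<close> edges.
    The three terms of the pruning condition cost at most \<open>e / 4\<close>, \<open>e / 8\<close>
    and \<open>e / 4\<close>; the last bound is the one that needs \<open>d\<close> to be huge
    compared with \<open>A * N * T\<close>.\<close>
  obtain X1 X2 X3 where X: "X1 \<subseteq> level (i - 1)" "X2 \<subseteq> Y" "X3 \<subseteq> V3" "X2 \<noteq> {}"
    and X1: "\<And>u. u \<in> X1 \<Longrightarrow> real A \<le> card (nb u X2)"
    and X21: "\<And>u. u \<in> X2 \<Longrightarrow> P / 2 \<le> card (nb u X1)"
    and X23: "\<And>u. u \<in> X2 \<Longrightarrow> c / 8 \<le> card (nb u X3)"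
    and X3: "\<And>u. u \<in> X3 \<Longrightarrow> D0 \<le> card (nb u X2)"
  proof (rule prune_layers[of "level (i - 1)" Y V3 "real A" "P / 2" "c / 8" D0 "2 * c"])
    fix u assume u: "u \<in> Y"
    show "2 * (P / 2) \<le> card (nb u (level (i - 1)))" using pY(1)[OF u] by (simp add: p_def)
    show "card (nb u V3) \<le> 2 * c"
      using rY(2)[OF u] card_nb_mono[OF fin, of V3 "Suc i" u] by (auto simp: V3_def r_def)
  next
    have "card V3 \<le> card (level (Suc i))" unfolding V3_def by (intro card_mono fin) auto
    then have "D0 * card V3 \<le> D0 * n3" using e_pos n3 by (intro mult_left_mono) (auto simp: D0_def n3_def)
    also have "\<dots> = e / 4" using n3 by (simp add: D0_def)
    finally have 1: "D0 * card V3 \<le> e / 4" .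
    have 2: "c / 8 * card Y \<le> e / 8" using e_ge by simp
    have "16 * (c * A * n1) \<le> P * e"
    proof -
      have "64 * real A * real N * 2 ^ j0 \<le> 64 * real A * real N * T" using j0T by (intro mult_left_mono) auto
      then have "64 * real A * real N * 2 ^ j0 \<le> d" using A(2) by (simp add: d_def)
      then have "(64 * real A * real N * 2 ^ j0) * (d * n1) \<le> d * (d * n1)" using d n1 by (intro mult_right_mono) auto
      also have "\<dots> \<le> 4 * N * (P * e)" by (rule e_n1)
      finally have "4 * N * (16 * (c * A * n1)) \<le> 4 * N * (P * e)" by (simp add: c_def mult_ac)
      then show ?thesis using N_pos by (simp add: mult_ac)
    qed
    then have 3: "2 * c / (P / 2) * A * n1 \<le> e / 4" using P by (simp add: field_simps)
    show "D0 * card V3 + c / 8 * card Y + 2 * c / (P / 2) * A * card (level (i - 1)) < ec Y V3"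
      using 1 2 3 split H3_le e_pos unfolding n1_def[symmetric] by linarith
  qed (use fin finY finV3 P c d e_pos n3 in \<open>auto simp: D0_def\<close>)
  define B where "B = nat \<lceil>P / 2\<rceil>"
  define C where "C = nat \<lceil>c / 8\<rceil>"
  \<comment> \<open>One is subtracted because \<open>trilayer\<close> asks for \<open>Suc D\<close>
    neighbours, which is then \<open>D0\<close> rounded up.\<close>
  define D where "D = nat \<lceil>D0\<rceil> - 1"
  define m where "m = nat \<lceil>real k / D\<rceil>"
  have ceil: "nat \<lceil>y\<rceil> \<le> n \<longleftrightarrow> y \<le> real n" for y :: real and n :: nat by (simp add: nat_le_iff ceiling_le_iff)
  have ceil_ge: "y \<le> real (nat \<lceil>y\<rceil>)" for y :: real by (rule real_nat_ceiling_ge)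
  have D0_6: "6 \<le> D0" using D0_ge K by simp
  have SucD: "Suc D = nat \<lceil>D0\<rceil>" using D0_6 by (simp add: D_def)
  have D_bounds: "D0 \<le> real D + 1" "real D < D0"
    using ceil_ge[of D0] ceil[of D0 D] SucD by (simp_all, linarith+)
  have D_half: "D0 / 2 \<le> D" using D_bounds D0_6 by linarith
  have D_pos: "0 < real D" using D_half D0_6 by linarith
  have "real D < real k" using D_bounds D0(1) by linarith
  then have Dk: "D \<le> k" by simp
  have kD: "1 \<le> real k / D" using Dk D_pos by simp
  have "real m < real k / D + 1"
    using kD unfolding m_def by (simp add: of_nat_ceiling) linarith
  moreover have "real k / D \<le> 2 * (k / D0)"
    using D_half D_pos D0_6 k_pos by (simp add: field_simps)
  ultimately have m_le: "real m \<le> 2 * (k / D0) + 1" by linarith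
  have kD0: "1 \<le> k / D0" using D0 D0_6 by simp
  \<comment> \<open>Here \<open>K \<ge> 96\<close> is spent: \<open>2 * m + 5\<close> is at most
    \<open>4 * (k / D0) + 7\<close>, hence at most 11 times \<open>k / D0\<close>, which is at least
    1.\<close>
  have P_ge: "12 * (k / D0) \<le> P / 2"
  proof -
    have "96 * real k \<le> K * k" using K by (intro mult_right_mono) auto
    then have "24 * real k \<le> P * D0" using D0(2) by linarith
    then show ?thesis using D0_6 by (simp add: field_simps)
  qed
  \<comment> \<open>\<open>S = 16\<close> because the forward degrees are at most
    \<open>2 * c\<close> while \<open>C \<ge> c / 8\<close>, and \<open>R = 4 * k\<close> because
    \<open>H3\<close> was removed; this makes \<open>1 + 2 * R * S\<close> equal to
    \<open>1 + 128 * k\<close>.\<close>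
  have "trilayer V E col x k i X1 X2 X3 A B C 16 D m (4 * k)"
  proof
    show "X2 \<subseteq> level i" "X3 \<subseteq> level (Suc i)" using X Y_level by (auto simp: V3_def)
    show "A \<le> card (nb u X2)" if "u \<in> X1" for u using X1[OF that] by simp
    show "B \<le> card (nb u X1)" if "u \<in> X2" for u unfolding B_def ceil by (rule X21[OF that])
    show "C \<le> card (nb u X3)" if "u \<in> X2" for u unfolding C_def ceil by (rule X23[OF that])
    show "card (nb u X3) \<le> 16 * C" if "u \<in> X2" for u
    proof -
      have "card (nb u X3) \<le> card (nb u (level (Suc i)))"
        using X(3) by (intro card_nb_mono fin) (auto simp: V3_def)
      moreover have "r u \<le> 2 * c" using rY X(2) that by blast
      moreover have "c / 8 \<le> C" unfolding C_def by (rule ceil_ge)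
      ultimately have "real (card (nb u X3)) \<le> real (16 * C)" unfolding r_def by simp
      then show ?thesis by simp
    qed
    show "Suc D \<le> card (nb w X2)" if "w \<in> X3" for w unfolding SucD ceil by (rule X3[OF that])
    show "card (nb w X2) \<le> 4 * k" if "w \<in> X3" for w
    proof -
      have "card (nb w X2) \<le> card (nb w Y)" using X(2) finY by (rule card_nb_mono[rotated])
      also have "\<dots> \<le> 4 * k" using that X(3) by (auto simp: V3_def H3_def)
      finally show ?thesis .
    qed
    show "1 \<le> D" using D_pos by simp
    show "1 \<le> m" using kD unfolding m_def by linarith
    have "D * (real k / D) \<le> D * real m"
      unfolding m_def by (intro mult_left_mono ceil_ge) simp
    then have "real k \<le> D * real m" using D_pos by simp
    then show "k \<le> D * m" by (simp flip: of_nat_mult)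
    have "P / 2 \<le> real B" unfolding B_def by (rule ceil_ge)
    then have "2 * real m + 5 \<le> real B" using m_le P_ge kD0 by linarith
    then have "real (2 * m + 5) \<le> real B" by simp
    then show "2 * m + 5 \<le> B" by (simp only: of_nat_le_iff)
    have "c / 8 \<le> real C" unfolding C_def by (rule ceil_ge)
    then have "real (4 * k) < real C" using c d k_pos by simp
    then show "4 * k < C" by (simp only: of_nat_less_iff)
    have "2 * k * (1 + 128 * k) ^ D \<le> 2 * k * (1 + 128 * k) ^ k"
      using Dk by (intro mult_left_mono power_increasing) auto
    then have "2 * k * (1 + 128 * k) ^ D + 2 * k < A" using A(1) by linarith
    moreover have "2 * (4 * k) * 16 = 128 * k" by simp
    ultimately show "2 * k * (1 + 2 * (4 * k) * 16) ^ D + 2 * k < A" by (simp only:)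
  qed (use i X in auto)
  then have "X1 = {}" by (rule trilayer.X1_empty)
  moreover obtain u where "u \<in> X2" using X(4) by blast
  ultimately show False using X21[of u] P by (simp add: nb_def)
qed

end

section \<open>The contradiction for dense bipartite graphs\<close>

lemma ln_2_ge_half: "1 / 2 \<le> ln (2 :: real)"
  using ln_le_minus_one[of "1 / 2 :: real"] by (simp add: ln_div)

lemma ln_ge_of_two_power:
  assumes "(2::real) ^ m \<le> x"
  shows "real m / 2 \<le> ln x"
proof -
  have "real m * (1 / 2) \<le> real m * ln 2" using ln_2_ge_half by (intro mult_left_mono) auto
  also have "\<dots> = ln (2 ^ m)" by (simp add: ln_realpow)
  also have "\<dots> \<le> ln x" using assms by (subst ln_le_cancel_iff) (auto intro: less_le_trans[of _ "2 ^ m"])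
  finally show ?thesis by simp
qed

context dense_even_cycle_free
begin

lemma level_growth_ratio:
  assumes "i < k"
  shows "(dl - 8 * k) / (2 * k) * card (level i) \<le> card (level (Suc i))"
proof -
  have "(dl - 8 * k) * card (level i) \<le> (dl - 6 * k) * card (level i)"
    by (intro mult_right_mono) auto
  also have "\<dots> \<le> 2 * k * real (card (level (Suc i)))" using level_growth[OF assms] by simp
  finally show ?thesis using k by (simp add: field_simps)
qed

lemma level_growth_power:
  assumes "i + j \<le> k"
  shows "((dl - 8 * k) / (2 * k)) ^ j * card (level i) \<le> card (level (i + j))"
  using assms
proof (induction j)
  case (Suc j)
  let ?r = "(dl - 8 * k) / (2 * k)"
  have "0 \<le> ?r" using dl by simp
  have "?r ^ Suc j * card (level i) = ?r * (?r ^ j * card (level i))" by simp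
  also have "\<dots> \<le> ?r * card (level (i + j))"
    using Suc \<open>0 \<le> ?r\<close> by (intro mult_left_mono) auto
  also have "\<dots> \<le> card (level (Suc (i + j)))" using Suc.prems by (intro level_growth_ratio) simp
  finally show ?case by simp
qed simp

text \<open>As long as \<open>sqrt k < 20 * ln k\<close>, each single step already multiplies the
  size by more than \<open>nu\<close>, so level \<open>k\<close> would have more than
  \<open>nu ^ k = n\<close> vertices.\<close>

lemma too_dense_small:
  fixes n :: nat and nu :: real
  assumes n: "card V \<le> n" and nu: "0 < nu" "nu ^ k = real n"
    and dense: "40 * sqrt k * ln k * nu \<le> dl - 8 * k" and "k < 1024"
  shows False
proof -
  have sqrt_less: "sqrt k < 20 * ln k"
  proof (cases "k < 64")
    case True
    then have "sqrt k < sqrt (8\<^sup>2)" by (intro real_sqrt_less_mono) simp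
    then have "sqrt k < 8" by simp
    also have "8 < 20 * ln (real k)" using ln_ge_of_two_power[of 1 k] k by simp
    finally show ?thesis .
  next
    case False
    have "sqrt k < sqrt (32\<^sup>2)" using assms(5) by (intro real_sqrt_less_mono) simp
    then have "sqrt k < 32" by simp
    also have "32 < 20 * ln (real k)" using ln_ge_of_two_power[of 6 k] False by simp
    finally show ?thesis .
  qed
  have "nu * (2 * k) = 2 * sqrt k * sqrt k * nu" by simp
  also have "\<dots> < 2 * sqrt k * (20 * ln k) * nu"
    using sqrt_less k nu by (intro mult_strict_right_mono mult_strict_left_mono) auto
  also have "\<dots> \<le> dl - 8 * k" using dense by (simp add: mult_ac)
  finally have "nu < (dl - 8 * k) / (2 * k)" using k by (simp add: field_simps)
  then have "nu ^ k < ((dl - 8 * k) / (2 * k)) ^ k" using nu k by (intro power_strict_mono) auto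
  also have "\<dots> \<le> card (level k)" using level_growth_power[of 0 k] by (simp add: level_0)
  also have "\<dots> \<le> card V" using card_mono[OF finite_V level_subset_V] by simp
  finally show False using n nu by simp
qed

text \<open>Every two steps multiply the size by more than \<open>nu\<close> squared. Starting from
  level 0 or level 1, according to the parity of \<open>k\<close>, this makes level \<open>k\<close>
  larger than \<open>nu ^ k = n\<close>.\<close>

lemma too_dense_large:
  fixes n :: nat and nu :: real
  assumes n: "card V \<le> n" and nu: "real ((2 * k) ^ (8 * k)) \<le> nu" "nu ^ k = real n"
    and dense: "40 * sqrt k * ln k * nu \<le> dl - 8 * k" and k_large: "1024 \<le> k"
    and max_root: "\<And>u. u \<in> V \<Longrightarrow> card (nb u V) \<le> card (nb x V)"
  shows False
proof -
  define d where "d = dl - 8 * k"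
  have card_level: "card (level i) \<le> n" for i
    using card_mono[OF finite_V level_subset_V] n by (rule order_trans)
  have "(2::real) ^ 10 \<le> k" using of_nat_mono[OF k_large, where 'a = real] by simp
  then have ln_k: "5 \<le> ln (real k)" using ln_ge_of_two_power[of 10 k] by simp
  have ln_le: "ln (real k) \<le> k" using k by (intro less_imp_le[OF ln_less_self]) simp
  have sqrt_k: "1 \<le> sqrt k" using k by simp
  have pow_nu: "real ((2 * k) ^ j) \<le> nu" if "j \<le> 8 * k" for j
  proof -
    have "(2 * k) ^ j \<le> (2 * k) ^ (8 * k)" using that k by (intro power_increasing) auto
    then show ?thesis using nu(1) of_nat_mono order_trans by blast
  qed
  have nu1: "1 \<le> nu" using pow_nu[of 0] by simp
  have d_nu: "nu \<le> d"
  proof -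
    have "1 \<le> 40 * sqrt k" using sqrt_k by linarith
    then have "1 * 1 \<le> (40 * sqrt k) * ln k" using ln_k by (intro mult_mono) linarith+
    then have "1 * nu \<le> (40 * sqrt k * ln k) * nu" using nu1 by (intro mult_right_mono) auto
    then show ?thesis using dense by (simp add: d_def)
  qed
  have d1: "1 \<le> d" using nu1 d_nu by linarith
  \<comment> \<open>The root has maximum degree, so level 1 is as large as the maximum degree;
    growing it by \<open>d / (2 * k)\<close> in each of \<open>k - 1\<close> steps must not exceed
    \<open>n = nu ^ k\<close>, which is at most \<open>d ^ k\<close>.\<close>
  define T where "T = (2 * real k) ^ (k - 1)"
  have T: "card (nb u V) \<le> d * T" if "u \<in> V" for u
  proof -
    have "(d / (2 * k)) ^ (k - 1) * card (level 1) \<le> card (level k)"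
      using level_growth_power[of 1 "k - 1"] k by (simp add: d_def)
    also have "\<dots> \<le> nu ^ k" using card_level nu by simp
    also have "\<dots> \<le> d ^ k" using d_nu nu1 by (intro power_mono) auto
    also have "\<dots> = d * d ^ (k - 1)" using k by (simp flip: power_Suc)
    finally have "d ^ (k - 1) * card (level 1) \<le> d ^ (k - 1) * (d * T)"
      using k by (simp add: T_def power_divide field_simps)
    then have "card (level 1) \<le> d * T" using d1 by simp
    moreover have "card (nb u V) \<le> card (level 1)" using max_root[OF that] nb_root by simp
    ultimately show ?thesis by linarith
  qed
  define N where "N = nat \<lceil>log 2 (4 * real k)\<rceil>"
  have log_pos: "0 \<le> log 2 (4 * real k)" using k by simp
  have N_pow: "4 * k \<le> 2 ^ N"
  proof -
    have "4 * real k = 2 powr log 2 (4 * real k)" using k by simp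
    also have "\<dots> \<le> 2 powr N" unfolding N_def by (intro powr_mono real_nat_ceiling_ge) auto
    finally have "real (4 * k) \<le> real (2 ^ N)" by (simp add: powr_realpow)
    then show ?thesis by (simp only: of_nat_le_iff)
  qed
  have N_le: "real N \<le> 3 * ln k"
  proof -
    have "real N \<le> log 2 (4 * real k) + 1" unfolding N_def using log_pos by linarith
    also have "log 2 (4 * real k) = 2 + ln k / ln 2"
    proof -
      have "ln (4 * real k) = ln (2\<^sup>2) + ln k" using k by (simp add: ln_mult)
      also have "ln (2\<^sup>2 :: real) = 2 * ln 2" using ln_realpow[of "2::real" 2] by simp
      finally show ?thesis by (simp add: log_def add_divide_distrib)
    qed
    also have "ln k / ln 2 \<le> ln k / (1 / 2)"
      using ln_k ln_2_ge_half by (intro divide_left_mono) auto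
    finally show ?thesis using ln_k by simp
  qed
  \<comment> \<open>Since \<open>1 + 128 * k\<close> is at most the square of \<open>2 * k\<close>,
    its power is at most \<open>(2 * k) ^ (2 * k)\<close>; the two further factors cover
    \<open>2 * k\<close> and the additive term.\<close>
  define A where "A = (2 * k) ^ (2 * k + 2)"
  have A1: "2 * k * (1 + 128 * k) ^ k + 2 * k < A"
  proof -
    have "1024 * k \<le> k * k" using k_large by (intro mult_right_mono) auto
    moreover have "(2 * k)\<^sup>2 = 4 * (k * k)" by (simp add: power2_eq_square)
    ultimately have "1 + 128 * k \<le> (2 * k)\<^sup>2" using k by linarith
    then have "(1 + 128 * k) ^ k \<le> ((2 * k)\<^sup>2) ^ k" by (intro power_mono) auto
    then have "2 * k * (1 + 128 * k) ^ k \<le> 2 * k * (2 * k) ^ (2 * k)"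
      unfolding power_mult[symmetric] by (rule mult_left_mono) simp
    moreover have "2 * k * 1 \<le> 2 * k * (2 * k) ^ (2 * k)" using k by (intro mult_left_mono) auto
    moreover have "2 * (2 * k * (2 * k) ^ (2 * k)) < (2 * k) * (2 * k * (2 * k) ^ (2 * k))"
      using k by (intro mult_strict_right_mono) auto
    ultimately show ?thesis by (simp only: A_def power_add power2_eq_square mult_ac mult_1_right)
  qed
  \<comment> \<open>\<open>64 * N\<close>, \<open>A\<close> and \<open>T\<close> contribute the
    exponents \<open>2\<close>, \<open>2 * k + 2\<close> and \<open>k - 1\<close> of
    \<open>2 * k\<close>. Their sum is below \<open>8 * k\<close>, where the lower bound on
    \<open>nu\<close> applies.\<close>
  have A2: "64 * real A * real N * T \<le> d"
  proof -
    have "real N \<le> 3 * real k" using N_le ln_le by linarith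
    moreover have "1024 * real k \<le> real k * real k" using k_large by (intro mult_right_mono) auto
    moreover have "(2 * real k)\<^sup>2 = 4 * (real k * real k)" by (simp add: power2_eq_square)
    ultimately have "64 * real N \<le> (2 * real k)\<^sup>2" by linarith
    then have "(64 * real N) * (A * T) \<le> (2 * real k)\<^sup>2 * (A * T)"
      by (intro mult_right_mono) (auto simp: T_def)
    also have "\<dots> = real ((2 * k) ^ (2 + (2 * k + 2 + (k - 1))))"
      by (simp only: A_def T_def power_add of_nat_power of_nat_mult of_nat_numeral)
    also have "\<dots> \<le> nu" using k by (intro pow_nu) auto
    finally show ?thesis using d_nu by (simp add: mult_ac)
  qed
  have large: "64 * k \<le> d"
  proof -
    have "64 * k \<le> (2 * k)\<^sup>2" using k_large by (simp add: power2_eq_square)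
    then have "real (64 * k) \<le> real ((2 * k) ^ 2)" by (rule of_nat_mono)
    also have "\<dots> \<le> nu" using k by (intro pow_nu) auto
    finally show ?thesis using d_nu by linarith
  qed
  have step: "nu\<^sup>2 * card (level i) < card (level (i + 2))" if i: "i + 2 \<le> k" for i
  proof -
    have "d\<^sup>2 * card (level (Suc i - 1)) < 4 * (96::real) * k * N * card (level (Suc (Suc i)))"
      unfolding d_def
      by (rule two_level_growth[where A = A and T = T]) (use i large N_pow T A1 A2 in \<open>auto simp: d_def\<close>)
    then have less: "d\<^sup>2 * card (level i) < 384 * real k * real N * real (card (level (i + 2)))" by simp
    \<comment> \<open>1600 is the square of 40, and 1152 is 3 times \<open>384 = 4 * 96\<close>, the
      3 coming from \<open>N \<le> 3 * ln k\<close>.\<close>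
    have "(40 * sqrt k * ln k * nu)\<^sup>2 \<le> d\<^sup>2"
      using dense ln_k nu1 by (intro power_mono) (auto simp: d_def)
    then have "1600 * k * ln k * ln k * nu\<^sup>2 \<le> d\<^sup>2"
      by (simp add: power_mult_distrib power2_eq_square[of "ln _"] mult_ac)
    moreover have "1152 * k * ln k * nu\<^sup>2 \<le> (1600 * k * ln k * nu\<^sup>2) * ln k"
    proof -
      have "(1152 * k * ln k * nu\<^sup>2) * 1 \<le> (1600 * k * ln k * nu\<^sup>2) * ln k"
        using ln_k by (intro mult_mono mult_right_mono) auto
      then show ?thesis by simp
    qed
    ultimately have "1152 * k * ln k * nu\<^sup>2 \<le> d\<^sup>2" by (simp add: mult_ac)
    then have "1152 * k * ln k * nu\<^sup>2 * card (level i) \<le> d\<^sup>2 * card (level i)" by (intro mult_right_mono) auto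
    also note less
    also have "384 * real k * real N * real (card (level (i + 2))) \<le> 384 * real k * (3 * ln k) * card (level (i + 2))"
      using N_le by (intro mult_right_mono mult_left_mono) auto
    finally have "(1152 * k * ln k) * (nu\<^sup>2 * card (level i)) < (1152 * k * ln k) * card (level (i + 2))"
      by (simp add: mult_ac)
    then show ?thesis using k ln_k by (simp add: mult_less_cancel_left_pos)
  qed
  have "nu ^ i \<le> card (level i)" if "i \<le> k" for i
    using that
  proof (induction i rule: less_induct)
    case (less i)
    consider "i = 0" | "i = 1" | j where "i = j + 2" by (metis One_nat_def add_2_eq_Suc' not0_implies_Suc)
    then show ?case
    proof cases
      case 2
      have "dl \<le> card (level 1)" using min_degree[OF x_V] nb_root by simp
      then show ?thesis using d_nu 2 by (simp add: d_def)
    next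
      case 3
      have "nu ^ i = nu\<^sup>2 * nu ^ j" by (simp only: 3 power_add mult.commute)
      also have "\<dots> \<le> nu\<^sup>2 * card (level j)" using less 3 by (intro mult_left_mono) auto
      also have "\<dots> \<le> card (level i)" using step[of j] less.prems 3 by simp
      finally show ?thesis .
    qed (simp add: level_0)
  qed
  from this[of "k - 2"] have "nu ^ (k - 2) \<le> card (level (k - 2))" by simp
  then have "nu\<^sup>2 * nu ^ (k - 2) \<le> nu\<^sup>2 * card (level (k - 2))" by (intro mult_left_mono) auto
  also have "\<dots> < card (level k)" using step[of "k - 2"] k by (simp only: le_add_diff_inverse2 order_refl)
  finally have "nu\<^sup>2 * nu ^ (k - 2) < n" using card_level[of k] by linarith
  moreover have "nu\<^sup>2 * nu ^ (k - 2) = nu ^ k"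
    using k by (simp only: power_add[symmetric] le_add_diff_inverse)
  ultimately show False using nu by simp
qed

end

section \<open>Reduction to bipartite graphs of large minimum degree\<close>

text \<open>Ordered pairs are counted, so every edge of a symmetric irreflexive relation contributes
  2.\<close>

definition pair_count :: "('a \<Rightarrow> 'a \<Rightarrow> bool) \<Rightarrow> 'a set \<Rightarrow> nat" where
  "pair_count R W = (\<Sum>u\<in>W. card {v \<in> W. R u v})"

lemma pair_count_insert:
  assumes sym: "\<And>u v. R u v \<Longrightarrow> R v u" and "\<not> R w w" and W: "finite W" "w \<notin> W"
  shows "pair_count R (insert w W) = pair_count R W + 2 * card {v \<in> W. R w v}"
proof -
  have w: "{v \<in> insert w W. R w v} = {v \<in> W. R w v}" using assms(2) by auto
  have u: "card {v \<in> insert w W. R u v} = card {v \<in> W. R u v} + of_bool (R u w)" for u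
  proof (cases "R u w")
    case True
    then have "{v \<in> insert w W. R u v} = insert w {v \<in> W. R u v}" by auto
    then show ?thesis using True W by simp
  next
    case False
    then have "{v \<in> insert w W. R u v} = {v \<in> W. R u v}" by auto
    then show ?thesis using False by simp
  qed
  have "(\<Sum>u\<in>W. of_bool (R u w) :: nat) = card {u \<in> W. R u w}"
    using W by (simp add: Int_def)
  also have "{u \<in> W. R u w} = {v \<in> W. R w v}" using sym by blast
  finally have "(\<Sum>u\<in>W. of_bool (R u w) :: nat) = card {v \<in> W. R w v}" .
  moreover have "pair_count R (insert w W)
      = card {v \<in> insert w W. R w v} + (\<Sum>u\<in>W. card {v \<in> insert w W. R u v})"
    using W by (simp only: pair_count_def sum.insert not_False_eq_True)
  ultimately show ?thesis unfolding w u sum.distrib by (simp only: pair_count_def)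
qed

text \<open>Each new vertex is put on the side opposite to the majority of its earlier neighbours,
  so at least half of its edges cross.\<close>

lemma ex_large_cut:
  assumes sym: "\<And>u v. R u v \<Longrightarrow> R v u" and irrefl: "\<And>u. \<not> R u u" and "finite W"
  shows "\<exists>S\<subseteq>W. pair_count R W \<le> 2 * pair_count (\<lambda>u v. R u v \<and> (u \<in> S) \<noteq> (v \<in> S)) W"
  using assms(3)
proof (induction W)
  case empty
  then show ?case by (simp add: pair_count_def)
next
  case (insert w W)
  let ?Q = "\<lambda>S u v. R u v \<and> (u \<in> S) \<noteq> (v \<in> S)"
  obtain S where S: "S \<subseteq> W" "pair_count R W \<le> 2 * pair_count (?Q S) W" using insert.IH by blast
  have pc: "pair_count (?Q S') (insert w W) = pair_count (?Q S') W + 2 * card {v \<in> W. ?Q S' w v}" for S'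
    by (rule pair_count_insert) (use sym irrefl insert.hyps in auto)
  have w: "w \<notin> S" using S insert.hyps by blast
  have eq: "pair_count (?Q (insert w S)) W = pair_count (?Q S) W"
    unfolding pair_count_def using insert.hyps(2) by (intro sum.cong arg_cong[of _ _ card]) auto
  define c1 c2 where "c1 = card {v \<in> W. R w v \<and> v \<in> S}" and "c2 = card {v \<in> W. R w v \<and> v \<notin> S}"
  have "{v \<in> W. R w v} = {v \<in> W. R w v \<and> v \<in> S} \<union> {v \<in> W. R w v \<and> v \<notin> S}" by auto
  then have "card {v \<in> W. R w v} \<le> c1 + c2" unfolding c1_def c2_def by (simp only: card_Un_le)
  then have total: "pair_count R (insert w W) \<le> pair_count R W + 2 * (c1 + c2)"
    using pair_count_insert[of R w W] sym irrefl insert.hyps by simp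
  have "{v \<in> W. ?Q S w v} = {v \<in> W. R w v \<and> v \<in> S}" using w by auto
  then have 1: "pair_count (?Q S) (insert w W) = pair_count (?Q S) W + 2 * c1"
    unfolding pc c1_def by simp
  have "{v \<in> W. ?Q (insert w S) w v} = {v \<in> W. R w v \<and> v \<notin> S}" using insert.hyps(2) by auto
  then have 2: "pair_count (?Q (insert w S)) (insert w W) = pair_count (?Q S) W + 2 * c2"
    unfolding pc eq c2_def by simp
  show ?case
  proof (cases "c1 \<le> c2")
    case True
    then show ?thesis using S total 2 by (intro exI[of _ "insert w S"]) auto
  next
    case False
    then show ?thesis using S total 1 by (intro exI[of _ S]) auto
  qed
qed

text \<open>In a smallest set with more than \<open>d\<close> edges per vertex, deleting a vertex of
  degree below \<open>d\<close> would leave a smaller such set.\<close>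

lemma ex_min_degree_subset:
  fixes d :: real
  assumes sym: "\<And>u v. R u v \<Longrightarrow> R v u" and irrefl: "\<And>u. \<not> R u u" and "finite V"
    and many: "2 * d * card V < pair_count R V"
  shows "\<exists>W\<subseteq>V. W \<noteq> {} \<and> (\<forall>u\<in>W. d \<le> card {v \<in> W. R u v})"
proof -
  obtain W where W: "W \<subseteq> V" "2 * d * card W < pair_count R W"
    and min: "\<And>U. \<lbrakk>U \<subseteq> V; 2 * d * card U < pair_count R U\<rbrakk> \<Longrightarrow> card W \<le> card U"
    using ex_has_least_nat[of "\<lambda>W. W \<subseteq> V \<and> 2 * d * card W < pair_count R W" V card] many by blast
  have finW: "finite W" using W assms(3) finite_subset by blast
  have "d \<le> card {v \<in> W. R u v}" if u: "u \<in> W" for u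
  proof (rule ccontr)
    assume less: "\<not> ?thesis"
    define U where "U = W - {u}"
    have WU: "W = insert u U" "u \<notin> U" "finite U" using u finW by (auto simp: U_def)
    have "pair_count R W = pair_count R U + 2 * card {v \<in> U. R u v}"
      unfolding WU(1) by (rule pair_count_insert) (use sym irrefl WU in auto)
    moreover have "{v \<in> U. R u v} = {v \<in> W. R u v}" using irrefl WU by auto
    moreover have "card W = Suc (card U)" using WU by simp
    ultimately have "2 * d * card U < pair_count R U" using W(2) less by (simp add: algebra_simps)
    then show False using min[of U] W(1) \<open>card W = Suc (card U)\<close> by (auto simp: U_def)
  qed
  moreover have "W \<noteq> {}" using W(2) by (auto simp: pair_count_def)
  ultimately show ?thesis using W(1) by blast
qed

lemma pair_count_edges:
  assumes "simple_graph G"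
  shows "2 * card (edges G) \<le> pair_count (\<lambda>u v. {u, v} \<in> edges G) (verts G)"
proof -
  have fin: "finite (verts G)" and e: "\<And>e. e \<in> edges G \<Longrightarrow> e \<subseteq> verts G \<and> card e = 2"
    using assms by (auto simp: simple_graph_def)
  have finE: "finite (edges G)" by (rule finite_subset[of _ "Pow (verts G)"]) (use fin e in auto)
  have "2 * card (edges G) = (\<Sum>e\<in>edges G. card {u \<in> verts G. u \<in> e})"
  proof -
    have "{u \<in> verts G. u \<in> e} = e" if "e \<in> edges G" for e using e[OF that] by auto
    then show ?thesis using e by simp
  qed
  also have "\<dots> = (\<Sum>e\<in>edges G. \<Sum>u\<in>verts G. of_bool (u \<in> e))"
    using fin by (simp add: Int_def)
  also have "\<dots> = (\<Sum>u\<in>verts G. card {e \<in> edges G. u \<in> e})"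
    using finE by (subst sum.swap) (simp add: Int_def)
  also have "\<dots> \<le> (\<Sum>u\<in>verts G. card {v \<in> verts G. {u, v} \<in> edges G})"
  proof (rule sum_mono)
    fix u
    have "{e \<in> edges G. u \<in> e} \<subseteq> (\<lambda>v. {u, v}) ` {v \<in> verts G. {u, v} \<in> edges G}"
    proof
      fix f assume f: "f \<in> {e \<in> edges G. u \<in> e}"
      then obtain a b where ab: "f = {a, b}" using e[of f] by (auto simp: card_2_iff)
      define v where "v = (if u = a then b else a)"
      have "f = {u, v}" using f ab by (auto simp: v_def)
      then show "f \<in> (\<lambda>v. {u, v}) ` {v \<in> verts G. {u, v} \<in> edges G}" using f e[of f] by auto
    qed
    then show "card {e \<in> edges G. u \<in> e} \<le> card {v \<in> verts G. {u, v} \<in> edges G}"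
      using fin by (intro surj_card_le) auto
  qed
  finally show ?thesis by (simp add: pair_count_def)
qed

lemma contains_copy_cycle:
  assumes "m \<ge> 1" "length ps = m" "distinct ps" "set ps \<subseteq> verts G"
    and path: "successively (\<lambda>u v. {u, v} \<in> edges G) ps" and closed: "{last ps, hd ps} \<in> edges G"
  shows "contains_copy G (cycle_graph m)"
  unfolding contains_copy_def
proof (intro exI[of _ "(!) ps"] conjI ballI)
  show "inj_on ((!) ps) (verts (cycle_graph m))"
    using assms(2,3) by (auto simp: cycle_graph_def inj_on_nth)
  show "(!) ps ` verts (cycle_graph m) \<subseteq> verts G"
    using assms(2,4) by (auto simp: cycle_graph_def)
  fix e assume "e \<in> edges (cycle_graph m)"
  then obtain i where i: "i < m" "e = {i, (i + 1) mod m}" by (auto simp: cycle_graph_def)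
  show "(!) ps ` e \<in> edges G"
  proof (cases "Suc i = m")
    case True
    have ne: "ps \<noteq> []" using assms(1,2) by auto
    then have "last ps = ps ! i" "hd ps = ps ! 0"
      using True assms(2) by (auto simp: last_conv_nth hd_conv_nth)
    then show ?thesis using closed True i by simp
  next
    case False
    then show ?thesis using path i assms(2) by (auto simp: successively_conv_nth)
  qed
qed

section \<open>The bound for a graph without cycles of length 2k\<close>

theorem even_cycle_edge_bound:
  fixes G :: "'a ugraph" and k n :: nat
  assumes k: "k \<ge> 2" and n: "n \<ge> (2 * k) ^ (8 * k\<^sup>2)"
    and G: "simple_graph G" "card (verts G) = n" "\<not> contains_copy G (cycle_graph (2 * k))"
  shows "real (card (edges G))
    \<le> 80 * sqrt (real k) * ln (real k) * real n powr (1 + 1 / real k) + 10 * (real k)\<^sup>2 * real n"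
proof (rule ccontr)
  assume contra: "\<not> ?thesis"
  define nu where "nu = real n powr (1 / real k)"
  \<comment> \<open>Half of the stated bound per vertex: \<open>2 * dl * n\<close> edges are
    exceeded, the cut keeps more than \<open>dl * n\<close> of them, and these force minimum degree
    \<open>dl\<close> on a subset. The summand \<open>5 * k^2\<close> absorbs the
    \<open>8 * k\<close> lost between the levels.\<close>
  define dl where "dl = 40 * sqrt k * ln k * nu + 5 * (real k)\<^sup>2"
  have "1 \<le> (2 * k) ^ (8 * k\<^sup>2)" using k by simp
  then have n_pos: "1 \<le> n" using n by linarith
  then have nu_pos: "0 < nu" by (simp add: nu_def)
  have nu_k: "nu ^ k = real n"
    using n_pos k by (simp add: nu_def powr_realpow[symmetric] powr_powr)
  have nu_ge: "real ((2 * k) ^ (8 * k)) \<le> nu"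
  proof (rule power_le_imp_le_base)
    have "real ((2 * k) ^ (8 * k)) ^ k = real ((2 * k) ^ (8 * k\<^sup>2))"
      by (simp only: of_nat_power power_mult[symmetric] power2_eq_square mult.assoc)
    also have "\<dots> \<le> real n" using n by (rule of_nat_mono)
    finally have "real ((2 * k) ^ (8 * k)) ^ k \<le> nu ^ k" using nu_k by simp
    moreover have "Suc (k - 1) = k" using k by simp
    ultimately show "real ((2 * k) ^ (8 * k)) ^ Suc (k - 1) \<le> nu ^ Suc (k - 1)" by (simp only:)
  qed (use nu_pos in simp)
  have "real n powr (1 + 1 / real k) = n * nu" using n_pos by (simp add: powr_add nu_def)
  then have many: "2 * dl * n < card (edges G)" using contra by (simp add: dl_def algebra_simps)
  define R where "R u v \<longleftrightarrow> {u, v} \<in> edges G" for u v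
  have R_sym: "R v u" if "R u v" for u v using that by (simp add: R_def insert_commute)
  have R_irrefl: "\<not> R u u" for u using G(1) by (auto simp: R_def simple_graph_def)
  have finV: "finite (verts G)" using G(1) by (simp add: simple_graph_def)
  obtain S where S: "pair_count R (verts G) \<le> 2 * pair_count (\<lambda>u v. R u v \<and> (u \<in> S) \<noteq> (v \<in> S)) (verts G)"
    using ex_large_cut[of R "verts G"] R_sym R_irrefl finV by blast
  define Q where "Q u v \<longleftrightarrow> R u v \<and> (u \<in> S) \<noteq> (v \<in> S)" for u v
  have Q_sym: "Q v u" if "Q u v" for u v using that R_sym by (auto simp: Q_def)
  have Q_irrefl: "\<not> Q u u" for u by (simp add: Q_def)
  have "card (edges G) \<le> pair_count Q (verts G)"
    using S pair_count_edges[OF G(1)] unfolding Q_def[abs_def] R_def[abs_def] by linarith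
  then have "2 * dl * card (verts G) < pair_count Q (verts G)" using many G(2) by simp
  with Q_sym Q_irrefl finV have "\<exists>W\<subseteq>verts G. W \<noteq> {} \<and> (\<forall>u\<in>W. dl \<le> card {v \<in> W. Q u v})"
    by (rule ex_min_degree_subset)
  then obtain W where W: "W \<subseteq> verts G" "W \<noteq> {}" "\<And>u. u \<in> W \<Longrightarrow> dl \<le> card {v \<in> W. Q u v}"
    by blast
  have finW: "finite W" using W(1) finV finite_subset by blast
  define E where "E u v \<longleftrightarrow> Q u v \<and> u \<in> W \<and> v \<in> W" for u v
  define deg where "deg u = card {v \<in> W. E u v}" for u
  have "Max (deg ` W) \<in> deg ` W" using finW W(2) by (intro Max_in) auto
  then obtain x where x: "x \<in> W" "Max (deg ` W) = deg x" by auto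
  have max: "deg u \<le> deg x" if "u \<in> W" for u
    using Max_ge[of "deg ` W" "deg u"] that finW x by simp
  have deg_ge: "dl \<le> deg u" if "u \<in> W" for u
  proof -
    have "{v \<in> W. E u v} = {v \<in> W. Q u v}" using that by (auto simp: E_def)
    then show ?thesis using W(3)[OF that] by (simp add: deg_def)
  qed
  have dl_ge: "40 * sqrt k * ln k * nu \<le> dl - 8 * k" "8 * real k \<le> dl"
  proof -
    have "2 * real k \<le> real k * real k" using k by (intro mult_right_mono) auto
    then have "8 * real k \<le> 5 * (real k)\<^sup>2" using k by (simp add: power2_eq_square)
    moreover have "0 \<le> 40 * sqrt k * ln k * nu" using k nu_pos by simp
    ultimately show "40 * sqrt k * ln k * nu \<le> dl - 8 * k" "8 * real k \<le> dl"
      unfolding dl_def of_nat_mult of_nat_numeral by linarith+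
  qed
  interpret bip_graph W E "\<lambda>u. u \<in> S"
    by unfold_locales (use finW Q_sym in \<open>auto simp: E_def Q_def\<close>)
  have nb_deg: "card (nb u W) = deg u" for u by (simp add: nb_def deg_def)
  interpret dense_even_cycle_free W E "\<lambda>u. u \<in> S" x k dl
  proof
    fix ps assume ps: "gpath E ps" "length ps = 2 * k"
    show "\<not> E (last ps) (hd ps)"
    proof
      assume closed: "E (last ps) (hd ps)"
      have "set ps \<subseteq> verts G"
      proof
        fix v assume "v \<in> set ps"
        then obtain j where j: "j < length ps" "v = ps ! j" by (auto simp: in_set_conv_nth)
        show "v \<in> verts G"
        proof (cases "Suc j < length ps")
          case True
          then have "E (ps ! j) (ps ! Suc j)" using ps(1) by (simp add: gpath_def successively_conv_nth)
          then show ?thesis using W(1) j by (auto simp: E_def)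
        next
          case False
          then have "v = last ps" using j by (metis Suc_lessI diff_Suc_1 last_conv_nth length_0_conv not_less_zero)
          then show ?thesis using closed W(1) by (auto simp: E_def)
        qed
      qed
      moreover have "successively (\<lambda>u v. {u, v} \<in> edges G) ps"
        using ps(1) by (auto simp: gpath_def E_def Q_def R_def elim!: successively_mono)
      ultimately have "contains_copy G (cycle_graph (2 * k))"
        using ps closed k by (intro contains_copy_cycle[of _ ps]) (auto simp: gpath_def E_def Q_def R_def)
      then show False using G(3) by simp
    qed
  qed (use x k deg_ge dl_ge in \<open>auto simp: nb_deg\<close>)
  have card_W: "card W \<le> n" using card_mono[OF finV W(1)] G(2) by simp
  show False
  proof (cases "k < 1024")
    case True
    then show False using too_dense_small[OF card_W nu_pos nu_k] dl_ge(1) by simp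
  next
    case False
    then show False
      using too_dense_large[OF card_W nu_ge nu_k dl_ge(1)] max by (simp add: nb_deg)
  qed
qed

theorem mainTheorem1:
  fixes k n :: nat
  assumes "k \<ge> 2"
    and "n \<ge> (2 * k) ^ (8 * k\<^sup>2)"
  shows "real (ex_num n (cycle_graph (2 * k)))
           \<le> 80 * sqrt (real k) * ln (real k) * real n powr (1 + 1 / real k) + 10 * (real k)\<^sup>2 * real n
       \<and> (\<forall>G :: 'a ugraph.
            simple_graph G \<and> card (verts G) = n \<and> \<not> contains_copy G (cycle_graph (2 * k)) \<longrightarrow>
            real (card (edges G))
              \<le> 80 * sqrt (real k) * ln (real k) * real n powr (1 + 1 / real k) + 10 * (real k)\<^sup>2 * real n)"
proof (intro conjI allI impI)
  let ?N = "{card (edges G) | G :: nat ugraph.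
     simple_graph G \<and> card (verts G) = n \<and> \<not> contains_copy G (cycle_graph (2 * k))}"
  have "{0, (0 + 1) mod (2 * k)} \<in> edges (cycle_graph (2 * k))"
    using assms(1) by (auto simp: cycle_graph_def intro!: exI[of _ 0])
  then have "edges (cycle_graph (2 * k)) \<noteq> {}" by blast
  \<comment> \<open>The maximum is attained because the set of edge counts is finite and, the cycle
    having an edge, nonempty.\<close>
  then have "ex_num n (cycle_graph (2 * k)) \<in> ?N"
    unfolding ex_num_def by (intro Max_in finite_edge_counts edge_counts_nonempty)
  then obtain G :: "nat ugraph" where "ex_num n (cycle_graph (2 * k)) = card (edges G)"
      "simple_graph G" "card (verts G) = n" "\<not> contains_copy G (cycle_graph (2 * k))"
    by blast
  then show "real (ex_num n (cycle_graph (2 * k)))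
    \<le> 80 * sqrt (real k) * ln (real k) * real n powr (1 + 1 / real k) + 10 * (real k)\<^sup>2 * real n"
    using even_cycle_edge_bound[OF assms, of G] by simp
qed (use even_cycle_edge_bound[OF assms] in blast)

end
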